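(* Let $\beta\in(0,2)\setminus\{1\}$ and let $(X_j)_{j\in\mathbb{N}}$ be an i.i.d. sequence of nonnegative random variables in the normal domain of attraction of a spectrally positive $\beta$-stable distribution. Let $(m_i)_{i\ge0}$ be real numbers with $m_0=1$ and $m_i>0$ for all $i$, and define $$Y_k:=\sum_{j=1}^k m_{k-j}X_j,\qquad S_n:=\sum_{k=1}^nY_k,\qquad L_n:=\sum_{k=1}^n\left(\sum_{i=0}^{n-k}m_i\right)^{\beta}.$$ Let $b_n:=0$ if $\beta\in(0,1)$ and $b_n:=\mathbb{E}[S_n]$ if $\beta\in(1,2)$. Then, for every $(x_n)_{n\in\mathbb{N}}$ such that $x_n\to\infty$ and $L_n\,\mathbb{P}[X_1>x_n]\to0$ as $n\to\infty$, $$\lim_{n\to\infty}\ \sup_{x\ge x_n}\left|\frac{\mathbb{P}[S_n-b_n>x]}{L_n\,\mathbb{P}[X_1>x]}-1\right|=0 .$$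
   Context: For nonnegative $X_1$ and $\beta\in(0,2)\setminus\{1\}$, being in the normal domain of attraction of a spectrally positive $\beta$-stable distribution means that the tail is regularly varying with index $-\beta$ with asymptotically constant slowly varying part, i.e. $\mathbb{P}[X_1>x]\sim c\,x^{-\beta}$ as $x\to\infty$ for some constant $c>0$. *)

theory Defs
  imports "HOL-Probability.Probability" "HOL-Library.Landau_Symbols"
begin

definition tail_prob :: "'a measure \<Rightarrow> ('a \<Rightarrow> real) \<Rightarrow> real \<Rightarrow> real" where
  "tail_prob M Z x = measure M {\<omega> \<in> space M. Z \<omega> > x}"

(* The sequence is indexed by j = 1, 2, ...; the value at index 0 is never used. *)
definition iid_seq :: "'a measure \<Rightarrow> (nat \<Rightarrow> 'a \<Rightarrow> real) \<Rightarrow> bool" where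
  "iid_seq M X \<longleftrightarrow>
     prob_space.indep_vars M (\<lambda>_. borel) X {1..} \<and>
     (\<forall>j\<ge>1. distr M borel (X j) = distr M borel (X 1))"

(* Membership in the normal domain of attraction of a spectrally positive
   beta-stable law, in the tail form valid for a nonnegative variable and
   beta in (0,2) without 1; only meant to be used under these conditions. *)
definition normal_doa_spectrally_positive ::
    "'a measure \<Rightarrow> real \<Rightarrow> ('a \<Rightarrow> real) \<Rightarrow> bool" where
  "normal_doa_spectrally_positive M \<beta> Z \<longleftrightarrow>
     (\<exists>c>0. tail_prob M Z \<sim>[at_top] (\<lambda>x. c * x powr (-\<beta>)))"

definition Y_proc :: "(nat \<Rightarrow> real) \<Rightarrow> (nat \<Rightarrow> 'a \<Rightarrow> real) \<Rightarrow> nat \<Rightarrow> 'a \<Rightarrow> real" where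
  "Y_proc m X k \<omega> = (\<Sum>j=1..k. m (k - j) * X j \<omega>)"

definition S_proc :: "(nat \<Rightarrow> real) \<Rightarrow> (nat \<Rightarrow> 'a \<Rightarrow> real) \<Rightarrow> nat \<Rightarrow> 'a \<Rightarrow> real" where
  "S_proc m X n \<omega> = (\<Sum>k=1..n. Y_proc m X k \<omega>)"

definition L_seq :: "real \<Rightarrow> (nat \<Rightarrow> real) \<Rightarrow> nat \<Rightarrow> real" where
  "L_seq \<beta> m n = (\<Sum>k=1..n. (\<Sum>i=0..n - k. m i) powr \<beta>)"

definition centering ::
    "'a measure \<Rightarrow> real \<Rightarrow> (nat \<Rightarrow> real) \<Rightarrow> (nat \<Rightarrow> 'a \<Rightarrow> real) \<Rightarrow> nat \<Rightarrow> real" where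
  "centering M \<beta> m X n = (if \<beta> < 1 then 0 else integral\<^sup>L M (S_proc m X n))"

end

(* One big jump.  S_n is the weighted sum of the X_j with weights A_{n-j} = m_0 + ... + m_{n-j};
   after division by x one has to compare P(sum U_j - centre > 1) with c D, where U_j has tail
   about c w_j t^(-beta) and D = sum w_j = L_n x^(-beta) is small.  Up to probability O(D^2) at
   most one U_j exceeds a small level tau, and the sum of the U_j truncated at tau deviates
   from its centre with probability O(D tau^(1-beta)) by Markov (beta < 1) or
   O(D tau^(2-beta)) by Chebyshev (beta > 1).  Hence the sum is large exactly when a single
   U_j is, up to o(D), uniformly in the number of summands and in the weights. *)
theory Submission
  imports Defs "HOL-Real_Asymp.Real_Asymp"
begin

text \<open>The claim is uniform in x and in arbitrary weights, so no limit in n can be taken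
  termwise. Everything is instead a finite inequality with constants that depend on \<beta>, c, K
  and \<epsilon> alone; n, x and m enter only through D. Smallness of D does double duty. It makes
  two large summands unlikely, and since each w_j is at most D it also makes every single weight
  A_{n-j}/x small, so that the power law of X_1, which holds only far out, applies to each U_j at
  the levels 1 - \<eta> and 1 + \<eta>. Two kinds of tail information are therefore kept apart: the
  sharp constant c at these levels, and a crude constant K valid at all positive levels, for the
  moment bounds. For \<beta> > 1 there is an extra obstacle: the centre is the full mean, while
  Chebyshev controls the sum around its truncated mean. The gap is O(D \<tau>^(1-\<beta>)), which
  blows up as \<tau> shrinks. It matters in the lower bound alone, since truncation can only
  decrease the mean.\<close>

text \<open>Both constants are sums of geometric series: moments of a variable with tail
  \<open>k t\<^sup>-\<^sup>\<beta>\<close> are bounded by cutting its range into dyadic shells around the truncation level.\<close>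

definition trunc_const :: "real \<Rightarrow> nat \<Rightarrow> real" where
  "trunc_const \<beta> p = 2 powr \<beta> / (1 - 2 powr (\<beta> - p))"

definition exceed_const :: "real \<Rightarrow> real" where
  "exceed_const \<beta> = 2 / (1 - 2 powr (1 - \<beta>))"

lemma trunc_const_pos: "\<beta> < real p \<Longrightarrow> 0 < trunc_const \<beta> p"
  by (simp add: trunc_const_def powr_less_one)

lemma exceed_const_pos: "1 < \<beta> \<Longrightarrow> 0 < exceed_const \<beta>"
  by (simp add: exceed_const_def powr_less_one)

section \<open>Dyadic moment bounds and variances of independent sums\<close>

context prob_space
begin

text \<open>Pointwise, f is at most the sum of all \<open>a k * indicator (A k)\<close>: where f is
  positive, the one index supplied by \<open>cover\<close> suffices and the other terms are
  nonnegative. The \<open>A k\<close> may overlap, so tail events can be used in place of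
  shells.\<close>

lemma nn_integral_le_geometric:
  fixes f :: "'a \<Rightarrow> real"
  assumes A: "\<And>k. A k \<in> events"
    and a: "\<And>k. 0 \<le> a k"
    and cover: "\<And>\<omega>. \<omega> \<in> space M \<Longrightarrow> f \<omega> > 0 \<Longrightarrow> \<exists>k. \<omega> \<in> A k \<and> f \<omega> \<le> a k"
    and bound: "\<And>k. a k * prob (A k) \<le> B * r ^ k"
    and r: "0 \<le> r" "r < 1" and B: "0 \<le> B"
  shows "(\<integral>\<^sup>+ \<omega>. ennreal (f \<omega>) \<partial>M) \<le> ennreal (B / (1 - r))"
proof -
  have "(\<integral>\<^sup>+ \<omega>. ennreal (f \<omega>) \<partial>M) \<le> (\<integral>\<^sup>+ \<omega>. (\<Sum>k. ennreal (a k) * indicator (A k) \<omega>) \<partial>M)"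
  proof (rule nn_integral_mono)
    fix \<omega> assume \<omega>: "\<omega> \<in> space M"
    show "ennreal (f \<omega>) \<le> (\<Sum>k. ennreal (a k) * indicator (A k) \<omega>)"
    proof (cases "f \<omega> > 0")
      case True
      then obtain k where k: "\<omega> \<in> A k" "f \<omega> \<le> a k"
        using cover[OF \<omega>] by blast
      have "ennreal (f \<omega>) \<le> ennreal (a k) * indicator (A k) \<omega>"
        using k by (simp add: ennreal_leI)
      also have "\<dots> = (\<Sum>j\<in>{k}. ennreal (a j) * indicator (A j) \<omega>)"
        by (simp only: sum.insert sum.empty finite.emptyI empty_iff not_False_eq_True add_0_right)
      also have "\<dots> \<le> (\<Sum>j. ennreal (a j) * indicator (A j) \<omega>)"
        by (rule sum_le_suminf) auto
      finally show ?thesis .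
    qed (simp add: ennreal_neg)
  qed
  also have "\<dots> = (\<Sum>k. ennreal (a k * prob (A k)))"
    using A a by (subst nn_integral_suminf)
      (auto simp: nn_integral_cmult_indicator emeasure_eq_measure ennreal_mult)
  also have "\<dots> \<le> (\<Sum>k. ennreal (B * r ^ k))"
    by (intro suminf_le ennreal_leI bound) auto
  also have "\<dots> = ennreal (B / (1 - r))"
  proof (rule suminf_ennreal_eq)
    show "(\<lambda>k. B * r ^ k) sums (B / (1 - r))"
      using sums_mult[OF geometric_sums[of r], of B] r by simp
  qed (use r B in auto)
  finally show ?thesis .
qed

text \<open>The shells descend from \<tau> by halving. The j-th one costs its upper edge to the
  power p times the tail at its lower edge; the half step between the edges gives the factor
  2^\<beta>, and the ratio 2^(\<beta>-p) is below 1 because \<beta> < p.\<close>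

lemma truncated_moment_le:
  fixes f :: "'a \<Rightarrow> real" and p :: nat and \<beta> k \<tau> :: real
  assumes f[measurable]: "random_variable borel f"
    and nonneg: "\<And>\<omega>. 0 \<le> f \<omega>"
    and tail: "\<And>t. 0 < t \<Longrightarrow> prob {\<omega> \<in> space M. f \<omega> > t} \<le> k * t powr - \<beta>"
    and k: "0 \<le> k" and p: "1 \<le> p" "\<beta> < real p" and \<tau>: "0 < \<tau>"
  shows "expectation (\<lambda>\<omega>. (if f \<omega> \<le> \<tau> then f \<omega> else 0) ^ p)
           \<le> k * trunc_const \<beta> p * \<tau> powr (p - \<beta>)"
proof (rule integral_real_bounded)
  have "(\<integral>\<^sup>+ \<omega>. ennreal ((if f \<omega> \<le> \<tau> then f \<omega> else 0) ^ p) \<partial>M)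
      \<le> ennreal ((k * 2 powr \<beta> * \<tau> powr (p - \<beta>)) / (1 - 2 powr (\<beta> - p)))"
  proof (rule nn_integral_le_geometric[where A = "\<lambda>j. {\<omega> \<in> space M. f \<omega> > \<tau> / 2 ^ (j + 1)}"
        and a = "\<lambda>j. (\<tau> / 2 ^ j) ^ p"])
    fix \<omega> assume \<omega>: "\<omega> \<in> space M" "0 < (if f \<omega> \<le> \<tau> then f \<omega> else 0) ^ p"
    then have *: "f \<omega> \<le> \<tau>" "f \<omega> > 0"
      using p nonneg[of \<omega>] by (auto split: if_splits simp: zero_less_power_eq less_le power_0_left)
    obtain n where "(1/2::real) ^ n < f \<omega> / \<tau>"
      using * \<tau> real_arch_pow_inv[of "f \<omega> / \<tau>" "1/2"] by auto
    then have "\<tau> / 2 ^ n < f \<omega>"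
      using \<tau> by (simp add: field_simps power_divide)
    \<comment> \<open>Index 0 fails because of the truncation, so the least index whose level lies
      below \<open>f \<omega>\<close> is a successor \<open>j + 1\<close>, and failure at j is the
      upper bound.\<close>
    moreover have "\<not> \<tau> / 2 ^ 0 < f \<omega>" using * by simp
    ultimately obtain j where "\<forall>i\<le>j. \<not> \<tau> / 2 ^ i < f \<omega>" "\<tau> / 2 ^ (j + 1) < f \<omega>"
      using ex_least_nat_less[of "\<lambda>n. \<tau> / 2 ^ n < f \<omega>" n] by auto
    then have "\<omega> \<in> {\<omega> \<in> space M. f \<omega> > \<tau> / 2 ^ (j + 1)}" "f \<omega> \<le> \<tau> / 2 ^ j"
      using \<omega> by (auto simp: not_less)
    then show "\<exists>j. \<omega> \<in> {\<omega> \<in> space M. f \<omega> > \<tau> / 2 ^ (j + 1)} \<and>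
        (if f \<omega> \<le> \<tau> then f \<omega> else 0) ^ p \<le> (\<tau> / 2 ^ j) ^ p"
      using * by (intro exI[of _ j] conjI) (auto intro!: power_mono)
  next
    fix j :: nat
    have e: "\<tau> / 2 ^ i = \<tau> * 2 powr - real i" for i
      by (simp add: powr_minus powr_realpow field_simps)
    have "(\<tau> / 2 ^ j) ^ p * prob {\<omega> \<in> space M. f \<omega> > \<tau> / 2 ^ (j + 1)}
        \<le> (\<tau> / 2 ^ j) ^ p * (k * (\<tau> / 2 ^ (j + 1)) powr - \<beta>)"
      using \<tau> by (intro mult_left_mono tail) auto
    also have "\<dots> = (\<tau> / 2 ^ j) powr p * (k * (\<tau> / 2 ^ (j + 1)) powr - \<beta>)"
      using \<tau> by (simp add: powr_realpow)
    also have "\<dots> = k * (\<tau> powr p * \<tau> powr - \<beta>) *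
        (2 powr (- real j * p) * 2 powr (- real (j + 1) * - \<beta>))"
      using \<tau> unfolding e by (simp add: powr_mult powr_powr)
    also have "\<dots> = k * \<tau> powr (p - \<beta>) * 2 powr (\<beta> + (\<beta> - p) * j)"
      unfolding powr_add[symmetric] by (simp add: algebra_simps)
    also have "\<dots> = k * 2 powr \<beta> * \<tau> powr (p - \<beta>) * (2 powr (\<beta> - p)) ^ j"
      by (simp add: powr_add powr_powr[symmetric] powr_realpow)
    finally show "(\<tau> / 2 ^ j) ^ p * prob {\<omega> \<in> space M. f \<omega> > \<tau> / 2 ^ (j + 1)}
        \<le> k * 2 powr \<beta> * \<tau> powr (p - \<beta>) * (2 powr (\<beta> - p)) ^ j" .
  next
    show "2 powr (\<beta> - real p) < 1" using p by (simp add: powr_less_one)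
  qed (use \<tau> k in auto)
  then show "(\<integral>\<^sup>+ \<omega>. ennreal ((if f \<omega> \<le> \<tau> then f \<omega> else 0) ^ p) \<partial>M)
      \<le> ennreal (k * trunc_const \<beta> p * \<tau> powr (p - \<beta>))"
    by (simp add: trunc_const_def field_simps)
next
  show "0 \<le> k * trunc_const \<beta> p * \<tau> powr (p - \<beta>)"
    using k trunc_const_pos[OF p(2)] by simp
qed

text \<open>Here the shells ascend from \<tau> by doubling, with ratio 2^(1-\<beta>), which is below
  1 because \<beta> > 1. A bound on the nonnegative integral yields integrability as well as a bound
  on the mean.\<close>

lemma nn_integral_exceedance_le:
  fixes f :: "'a \<Rightarrow> real"
  assumes f[measurable]: "random_variable borel f"
    and tail: "\<And>t. 0 < t \<Longrightarrow> prob {\<omega> \<in> space M. f \<omega> > t} \<le> k * t powr - \<beta>"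
    and k: "0 \<le> k" and \<beta>: "1 < \<beta>" and \<tau>: "0 < \<tau>"
  shows "(\<integral>\<^sup>+ \<omega>. ennreal (if f \<omega> \<le> \<tau> then 0 else f \<omega>) \<partial>M)
           \<le> ennreal (k * exceed_const \<beta> * \<tau> powr (1 - \<beta>))"
proof -
  have "(\<integral>\<^sup>+ \<omega>. ennreal (if f \<omega> \<le> \<tau> then 0 else f \<omega>) \<partial>M)
      \<le> ennreal ((k * 2 * \<tau> powr (1 - \<beta>)) / (1 - 2 powr (1 - \<beta>)))"
  proof (rule nn_integral_le_geometric[where A = "\<lambda>j. {\<omega> \<in> space M. f \<omega> > \<tau> * 2 ^ j}"
        and a = "\<lambda>j. \<tau> * 2 ^ (j + 1)"])
    fix \<omega> assume \<omega>: "\<omega> \<in> space M" "0 < (if f \<omega> \<le> \<tau> then 0 else f \<omega>)"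
    then have *: "f \<omega> > \<tau>" by (auto split: if_splits)
    obtain n where "f \<omega> / \<tau> < 2 ^ n"
      using real_arch_pow[of 2 "f \<omega> / \<tau>"] by auto
    then have "f \<omega> \<le> \<tau> * 2 ^ n"
      using \<tau> by (simp add: field_simps)
    moreover have "\<not> f \<omega> \<le> \<tau> * 2 ^ 0" using * by simp
    ultimately obtain j where "\<forall>i\<le>j. \<not> f \<omega> \<le> \<tau> * 2 ^ i" "f \<omega> \<le> \<tau> * 2 ^ (j + 1)"
      using ex_least_nat_less[of "\<lambda>n. f \<omega> \<le> \<tau> * 2 ^ n" n] by auto
    then show "\<exists>j. \<omega> \<in> {\<omega> \<in> space M. f \<omega> > \<tau> * 2 ^ j} \<and>
        (if f \<omega> \<le> \<tau> then 0 else f \<omega>) \<le> \<tau> * 2 ^ (j + 1)"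
      using \<omega> \<tau> by (intro exI[of _ j]) (auto simp: not_le)
  next
    fix j :: nat
    have e: "\<tau> * 2 ^ i = \<tau> * 2 powr real i" for i
      by (simp add: powr_realpow)
    have "\<tau> * 2 ^ (j + 1) * prob {\<omega> \<in> space M. f \<omega> > \<tau> * 2 ^ j}
        \<le> \<tau> * 2 ^ (j + 1) * (k * (\<tau> * 2 ^ j) powr - \<beta>)"
      using \<tau> by (intro mult_left_mono tail) auto
    also have "\<dots> = \<tau> powr 1 * 2 powr (j + 1) * (k * (\<tau> powr - \<beta> * 2 powr (j * - \<beta>)))"
      using \<tau> unfolding e by (simp add: powr_mult powr_powr)
    also have "\<dots> = k * (\<tau> powr 1 * \<tau> powr - \<beta>) * (2 powr (j + 1) * 2 powr (j * - \<beta>))"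
      by (simp only: mult_ac)
    also have "\<dots> = k * \<tau> powr (1 - \<beta>) * 2 powr (1 + (1 - \<beta>) * j)"
      unfolding powr_add[symmetric] by (simp add: algebra_simps)
    also have "\<dots> = k * 2 * \<tau> powr (1 - \<beta>) * (2 powr (1 - \<beta>)) ^ j"
      by (simp add: powr_add powr_powr[symmetric] powr_realpow)
    finally show "\<tau> * 2 ^ (j + 1) * prob {\<omega> \<in> space M. f \<omega> > \<tau> * 2 ^ j}
        \<le> k * 2 * \<tau> powr (1 - \<beta>) * (2 powr (1 - \<beta>)) ^ j" .
  next
    show "2 powr (1 - \<beta>) < (1::real)" using \<beta> by (simp add: powr_less_one)
  qed (use \<tau> k in auto)
  then show ?thesis by (simp add: exceed_const_def field_simps)
qed

lemma
  fixes X Y :: "'a \<Rightarrow> real"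
  assumes indep: "indep_var borel X borel Y"
    and X: "integrable M X" "integrable M (\<lambda>\<omega>. (X \<omega>)\<^sup>2)"
    and Y: "integrable M Y" "integrable M (\<lambda>\<omega>. (Y \<omega>)\<^sup>2)"
  shows integrable_power2_add_indep: "integrable M (\<lambda>\<omega>. (X \<omega> + Y \<omega>)\<^sup>2)"
    and variance_add_indep: "variance (\<lambda>\<omega>. X \<omega> + Y \<omega>) = variance X + variance Y"
proof -
  have XY: "integrable M (\<lambda>\<omega>. X \<omega> * Y \<omega>)"
    by (rule indep_var_integrable[OF indep X(1) Y(1)])
  then show int: "integrable M (\<lambda>\<omega>. (X \<omega> + Y \<omega>)\<^sup>2)"
    using X Y by (simp add: power2_sum mult.assoc)
  have "variance (\<lambda>\<omega>. X \<omega> + Y \<omega>) =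
      expectation (\<lambda>\<omega>. (X \<omega> + Y \<omega>)\<^sup>2) - (expectation X + expectation Y)\<^sup>2"
    using X Y int by (subst variance_eq) auto
  also have "expectation (\<lambda>\<omega>. (X \<omega> + Y \<omega>)\<^sup>2) =
      expectation (\<lambda>\<omega>. (X \<omega>)\<^sup>2) + expectation (\<lambda>\<omega>. (Y \<omega>)\<^sup>2) + 2 * expectation (\<lambda>\<omega>. X \<omega> * Y \<omega>)"
    using X Y XY by (simp add: power2_sum mult.assoc)
  also have "expectation (\<lambda>\<omega>. X \<omega> * Y \<omega>) = expectation X * expectation Y"
    by (rule indep_var_lebesgue_integral[OF indep X(1) Y(1)])
  finally show "variance (\<lambda>\<omega>. X \<omega> + Y \<omega>) = variance X + variance Y"
    using X Y by (simp add: variance_eq power2_sum algebra_simps)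
qed

text \<open>Integrability of the squared partial sum is carried through the induction, because
  additivity of the variance needs it at every step. Second moments replace variances since these
  are what truncation controls.\<close>

lemma variance_sum_indep_le:
  fixes Z :: "'i \<Rightarrow> 'a \<Rightarrow> real"
  assumes "finite I" "indep_vars (\<lambda>_. borel) Z I"
    and "\<And>i. i \<in> I \<Longrightarrow> integrable M (Z i)"
    and "\<And>i. i \<in> I \<Longrightarrow> integrable M (\<lambda>\<omega>. (Z i \<omega>)\<^sup>2)"
  shows "integrable M (\<lambda>\<omega>. (\<Sum>i\<in>I. Z i \<omega>)\<^sup>2) \<and>
         variance (\<lambda>\<omega>. \<Sum>i\<in>I. Z i \<omega>) \<le> (\<Sum>i\<in>I. expectation (\<lambda>\<omega>. (Z i \<omega>)\<^sup>2))"
  using assms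
proof (induction I)
  case (insert i I)
  have IH: "integrable M (\<lambda>\<omega>. (\<Sum>i\<in>I. Z i \<omega>)\<^sup>2)"
    "variance (\<lambda>\<omega>. \<Sum>i\<in>I. Z i \<omega>) \<le> (\<Sum>i\<in>I. expectation (\<lambda>\<omega>. (Z i \<omega>)\<^sup>2))"
    using insert.IH[OF indep_vars_subset[OF insert.prems(1)]] insert.prems by auto
  have indep: "indep_var borel (Z i) borel (\<lambda>\<omega>. \<Sum>i\<in>I. Z i \<omega>)"
    by (rule indep_vars_sum[OF insert.hyps insert.prems(1)])
  have Zi: "integrable M (Z i)" "integrable M (\<lambda>\<omega>. (Z i \<omega>)\<^sup>2)"
    and S: "integrable M (\<lambda>\<omega>. \<Sum>i\<in>I. Z i \<omega>)"
    using insert.prems by auto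
  have "variance (Z i) \<le> expectation (\<lambda>\<omega>. (Z i \<omega>)\<^sup>2)"
    using Zi by (simp add: variance_eq)
  then show ?case
    using insert.hyps IH integrable_power2_add_indep[OF indep Zi S IH(1)]
      variance_add_indep[OF indep Zi S IH(1)] by simp
qed simp

end

section \<open>Independent nonnegative summands with weighted power-law tails\<close>

text \<open>The index set and the weights are arbitrary and K is common to all summands and levels.
  Bounds proved here in terms of K and \<open>D\<close> are thus automatically uniform in n and x
  when the locale is instantiated.\<close>

locale heavy_sum = prob_space +
  fixes I :: "'i set" and U :: "'i \<Rightarrow> 'a \<Rightarrow> real" and w :: "'i \<Rightarrow> real" and \<beta> K :: real
  assumes finite_I: "finite I"
    and indep: "indep_vars (\<lambda>_. borel) U I"
    and nonneg: "\<And>i \<omega>. i \<in> I \<Longrightarrow> 0 \<le> U i \<omega>"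
    and w_nonneg: "\<And>i. i \<in> I \<Longrightarrow> 0 \<le> w i"
    and K_nonneg: "0 \<le> K"
    and tail: "\<And>i t. i \<in> I \<Longrightarrow> 0 < t \<Longrightarrow> prob {\<omega> \<in> space M. U i \<omega> > t} \<le> K * w i * t powr - \<beta>"
begin

definition D :: real where "D = (\<Sum>i\<in>I. w i)"

text \<open>Values above \<tau> become 0 rather than \<tau>, so that \<open>U i - Z \<tau> i\<close>
  is either 0 or the entire big jump.\<close>

definition Z :: "real \<Rightarrow> 'i \<Rightarrow> 'a \<Rightarrow> real" where
  "Z \<tau> i \<omega> = (if U i \<omega> \<le> \<tau> then U i \<omega> else 0)"

lemma D_nonneg: "0 \<le> D"
  unfolding D_def by (intro sum_nonneg w_nonneg)

lemma U_measurable[measurable]: "i \<in> I \<Longrightarrow> random_variable borel (U i)"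
  using indep by (auto simp: indep_vars_def)

lemma Z_measurable[measurable]: "i \<in> I \<Longrightarrow> random_variable borel (Z \<tau> i)"
  unfolding Z_def by measurable

lemma Z_bounds:
  assumes "i \<in> I" "0 < \<tau>"
  shows "0 \<le> Z \<tau> i \<omega>" "Z \<tau> i \<omega> \<le> \<tau>" "Z \<tau> i \<omega> \<le> U i \<omega>"
  using nonneg[OF assms(1), of \<omega>] assms(2) by (auto simp: Z_def)

lemma integrable_Z_power: "i \<in> I \<Longrightarrow> 0 < \<tau> \<Longrightarrow> integrable M (\<lambda>\<omega>. Z \<tau> i \<omega> ^ p)"
  using Z_bounds[of i \<tau>]
  by (intro integrable_const_bound[where B = "\<tau> ^ p"]) (auto intro!: power_mono)

lemma integrable_Z: "i \<in> I \<Longrightarrow> 0 < \<tau> \<Longrightarrow> integrable M (Z \<tau> i)"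
  using integrable_Z_power[of i \<tau> 1] by simp

lemma indep_Z: "J \<subseteq> I \<Longrightarrow> indep_vars (\<lambda>_. borel) (Z \<tau>) J"
  using indep_vars_compose2[OF indep_vars_subset[OF indep, of J],
      of "\<lambda>_ x. if x \<le> \<tau> then x else 0" "\<lambda>_. borel"]
  by (simp add: Z_def[abs_def])

lemma Z_moment_le:
  assumes "i \<in> I" "1 \<le> p" "\<beta> < real p" "0 < \<tau>"
  shows "expectation (\<lambda>\<omega>. Z \<tau> i \<omega> ^ p) \<le> K * w i * trunc_const \<beta> p * \<tau> powr (p - \<beta>)"
  unfolding Z_def using assms nonneg tail K_nonneg w_nonneg by (intro truncated_moment_le) auto

lemma sum_tail_le: "J \<subseteq> I \<Longrightarrow> 0 < t \<Longrightarrow>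
  (\<Sum>i\<in>J. prob {\<omega> \<in> space M. U i \<omega> > t}) \<le> K * D * t powr - \<beta>"
proof -
  assume J: "J \<subseteq> I" and t: "0 < t"
  have "(\<Sum>i\<in>J. prob {\<omega> \<in> space M. U i \<omega> > t}) \<le> (\<Sum>i\<in>I. prob {\<omega> \<in> space M. U i \<omega> > t})"
    using J finite_I by (intro sum_mono2) auto
  also have "\<dots> \<le> (\<Sum>i\<in>I. K * w i * t powr - \<beta>)"
    using t by (intro sum_mono tail) auto
  also have "\<dots> = K * D * t powr - \<beta>"
    by (simp add: D_def sum_distrib_left sum_distrib_right)
  finally show ?thesis .
qed

text \<open>A subset J is allowed because the lower bound removes one summand. The estimate still
  features the full \<open>D\<close>, as leaving out summands only decreases the sum of second
  moments.\<close>

lemma Z_deviation_le: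
  assumes J: "J \<subseteq> I" and "\<beta> < 2" "0 < \<tau>" "0 < a"
  shows "prob {\<omega> \<in> space M. \<bar>(\<Sum>i\<in>J. Z \<tau> i \<omega>) - (\<Sum>i\<in>J. expectation (Z \<tau> i))\<bar> \<ge> a}
           \<le> K * D * trunc_const \<beta> 2 * \<tau> powr (2 - \<beta>) / a\<^sup>2"
proof -
  have fin: "finite J" using J finite_I by (rule finite_subset)
  have int: "integrable M (Z \<tau> i)" "integrable M (\<lambda>\<omega>. (Z \<tau> i \<omega>)\<^sup>2)" if "i \<in> J" for i
    using integrable_Z integrable_Z_power that J assms(3) by blast+
  note V = variance_sum_indep_le[OF fin indep_Z[OF J] int, simplified]
  have rv: "random_variable borel (\<lambda>\<omega>. \<Sum>i\<in>J. Z \<tau> i \<omega>)"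
    using J by (intro borel_measurable_sum Z_measurable) auto
  have "prob {\<omega> \<in> space M. \<bar>(\<Sum>i\<in>J. Z \<tau> i \<omega>) - expectation (\<lambda>\<omega>. \<Sum>i\<in>J. Z \<tau> i \<omega>)\<bar> \<ge> a}
      \<le> variance (\<lambda>\<omega>. \<Sum>i\<in>J. Z \<tau> i \<omega>) / a\<^sup>2"
    using V assms(4) by (intro Chebyshev_inequality rv) auto
  also have "\<dots> \<le> (\<Sum>i\<in>J. expectation (\<lambda>\<omega>. (Z \<tau> i \<omega>)\<^sup>2)) / a\<^sup>2"
    using V by (intro divide_right_mono) auto
  also have "(\<Sum>i\<in>J. expectation (\<lambda>\<omega>. (Z \<tau> i \<omega>)\<^sup>2)) \<le> (\<Sum>i\<in>I. expectation (\<lambda>\<omega>. (Z \<tau> i \<omega>)\<^sup>2))"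
    using J finite_I by (intro sum_mono2) auto
  also have "\<dots> \<le> (\<Sum>i\<in>I. K * w i * trunc_const \<beta> 2 * \<tau> powr (real 2 - \<beta>))"
    using assms(2,3) by (intro sum_mono Z_moment_le) auto
  also have "\<dots> = K * D * trunc_const \<beta> 2 * \<tau> powr (2 - \<beta>)"
    by (simp add: D_def sum_distrib_left sum_distrib_right)
  finally show ?thesis
    using int by (simp add: divide_right_mono)
qed

lemma Z_sum_Markov:
  assumes "\<beta> < 1" "0 < \<tau>" "0 < a"
  shows "prob {\<omega> \<in> space M. (\<Sum>i\<in>I. Z \<tau> i \<omega>) \<ge> a} \<le> K * D * trunc_const \<beta> 1 * \<tau> powr (1 - \<beta>) / a"
proof -
  have "prob {\<omega> \<in> space M. (\<Sum>i\<in>I. Z \<tau> i \<omega>) \<ge> a} \<le> expectation (\<lambda>\<omega>. \<Sum>i\<in>I. Z \<tau> i \<omega>) / a"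
    using assms Z_bounds(1) integrable_Z
    by (intro integral_Markov_inequality_measure[where A = "space M"]) (auto intro!: sum_nonneg)
  also have "expectation (\<lambda>\<omega>. \<Sum>i\<in>I. Z \<tau> i \<omega>) = (\<Sum>i\<in>I. expectation (\<lambda>\<omega>. Z \<tau> i \<omega> ^ 1))"
    using assms integrable_Z by simp
  also have "\<dots> \<le> (\<Sum>i\<in>I. K * w i * trunc_const \<beta> 1 * \<tau> powr (real 1 - \<beta>))"
    using assms by (intro sum_mono Z_moment_le) auto
  also have "\<dots> = K * D * trunc_const \<beta> 1 * \<tau> powr (1 - \<beta>)"
    by (simp add: D_def sum_distrib_left sum_distrib_right)
  finally show ?thesis using assms(3) by (simp add: divide_right_mono)
qed

text \<open>Splitting \<open>U i\<close> into \<open>Z \<tau> i\<close> and the exceedance over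
  \<tau> bounds the bias that truncation causes in the mean when \<beta> > 1.\<close>

lemma
  assumes i: "i \<in> I" and "1 < \<beta>" "0 < \<tau>"
  shows integrable_U: "integrable M (U i)"
    and expectation_U_le: "expectation (U i)
      \<le> expectation (Z \<tau> i) + K * w i * exceed_const \<beta> * \<tau> powr (1 - \<beta>)"
proof -
  define E where "E \<omega> = (if U i \<omega> \<le> \<tau> then 0 else U i \<omega>)" for \<omega>
  have [measurable]: "random_variable borel E" unfolding E_def using i by measurable
  have E_nonneg: "0 \<le> E \<omega>" for \<omega> using nonneg[OF i] by (simp add: E_def)
  have bound: "(\<integral>\<^sup>+ \<omega>. ennreal (E \<omega>) \<partial>M) \<le> ennreal (K * w i * exceed_const \<beta> * \<tau> powr (1 - \<beta>))"
    unfolding E_def using assms tail K_nonneg w_nonneg by (intro nn_integral_exceedance_le) auto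
  have E: "integrable M E"
    using bound E_nonneg by (intro integrableI_nonneg) (auto simp: le_less_trans)
  have U: "U i = (\<lambda>\<omega>. Z \<tau> i \<omega> + E \<omega>)" by (auto simp: Z_def E_def)
  show "integrable M (U i)" using E integrable_Z[OF i assms(3)] by (simp add: U)
  have "expectation E \<le> K * w i * exceed_const \<beta> * \<tau> powr (1 - \<beta>)"
    using bound K_nonneg w_nonneg[OF i] exceed_const_pos[OF assms(2)]
    by (intro integral_real_bounded) auto
  then show "expectation (U i)
      \<le> expectation (Z \<tau> i) + K * w i * exceed_const \<beta> * \<tau> powr (1 - \<beta>)"
    using E integrable_Z[OF i assms(3)] by (simp add: U)
qed

text \<open>Both uses of independence are instances: \<open>J = I - {j}\<close> separates a big jump
  from the rest of the sum, and a singleton J separates two big jumps.\<close>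

lemma prob_tail_Int_sum:
  assumes J: "j \<in> I" "J \<subseteq> I - {j}" and B: "B \<in> sets borel"
  shows "prob ({\<omega> \<in> space M. U j \<omega> > t} \<inter> {\<omega> \<in> space M. (\<Sum>i\<in>J. U i \<omega>) \<in> B})
    = prob {\<omega> \<in> space M. U j \<omega> > t} * prob {\<omega> \<in> space M. (\<Sum>i\<in>J. U i \<omega>) \<in> B}"
proof -
  have "finite J" "j \<notin> J" using J finite_I by (auto intro: finite_subset)
  then have "indep_var borel (U j) borel (\<lambda>\<omega>. \<Sum>i\<in>J. U i \<omega>)"
    using J by (intro indep_vars_sum indep_vars_subset[OF indep]) auto
  from indep_varD[OF this, of "{t<..}" B] B show ?thesis
    by (simp add: vimage_def Int_def conj_ac cong: conj_cong)
qed

lemma prob_tail_Int_tail: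
  assumes "i \<in> I" "j \<in> I" "i \<noteq> j"
  shows "prob ({\<omega> \<in> space M. U j \<omega> > t} \<inter> {\<omega> \<in> space M. U i \<omega> > t})
    = prob {\<omega> \<in> space M. U j \<omega> > t} * prob {\<omega> \<in> space M. U i \<omega> > t}"
  using prob_tail_Int_sum[of j "{i}" "{t<..}" t] assms by simp

text \<open>Suppose that no summand exceeds 1 - \<eta>, no two exceed \<tau>, and the truncated sum
  minus b stays below \<eta>. Then the differences \<open>U i - Z \<tau> i\<close> have at most one
  nonzero term and add up to at most 1 - \<eta>, so the sum minus b stays below 1. The three terms
  on the right bound the failure of these conditions.\<close>

lemma prob_sum_gt_le:
  assumes \<tau>: "0 < \<tau>" and \<eta>: "0 < \<eta>" "\<eta> < 1"
  shows "prob {\<omega> \<in> space M. (\<Sum>i\<in>I. U i \<omega>) - b > 1}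
    \<le> (\<Sum>i\<in>I. prob {\<omega> \<in> space M. U i \<omega> > 1 - \<eta>}) + (K * D * \<tau> powr - \<beta>)\<^sup>2
      + prob {\<omega> \<in> space M. (\<Sum>i\<in>I. Z \<tau> i \<omega>) - b \<ge> \<eta>}"
proof -
  define A where "A i = {\<omega> \<in> space M. U i \<omega> > 1 - \<eta>}" for i
  define T where "T i = {\<omega> \<in> space M. U i \<omega> > \<tau>}" for i
  define P where "P = {(i, j) \<in> I \<times> I. i \<noteq> j}"
  define R where "R = {\<omega> \<in> space M. (\<Sum>i\<in>I. Z \<tau> i \<omega>) - b \<ge> \<eta>}"
  have [measurable]: "A i \<in> events" "T i \<in> events" if "i \<in> I" for i
    unfolding A_def T_def using that by measurable
  have [measurable]: "R \<in> events" unfolding R_def by measurable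
  have P: "finite P" "P \<subseteq> I \<times> I" unfolding P_def using finite_I
    by (auto intro: finite_subset[of _ "I \<times> I"])
  have AI: "(\<Union>i\<in>I. A i) \<in> events" using finite_I by auto
  have TP: "(\<Union>(i, j)\<in>P. T j \<inter> T i) \<in> events" using P by (intro sets.finite_UN) auto
  have "{\<omega> \<in> space M. (\<Sum>i\<in>I. U i \<omega>) - b > 1} \<subseteq> (\<Union>i\<in>I. A i) \<union> (\<Union>(i, j)\<in>P. T j \<inter> T i) \<union> R"
  proof
    fix \<omega> assume \<omega>: "\<omega> \<in> {\<omega> \<in> space M. (\<Sum>i\<in>I. U i \<omega>) - b > 1}"
    show "\<omega> \<in> (\<Union>i\<in>I. A i) \<union> (\<Union>(i, j)\<in>P. T j \<inter> T i) \<union> R"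
    proof (rule ccontr)
      assume neg: "\<not> ?thesis"
      have le: "U i \<omega> \<le> 1 - \<eta>" if "i \<in> I" for i
        using neg that \<omega> by (auto simp: A_def not_less)
      have uniq: "i = j" if "i \<in> I" "j \<in> I" "U i \<omega> > \<tau>" "U j \<omega> > \<tau>" for i j
        using neg that \<omega> by (auto simp: P_def T_def)
      have Zlt: "(\<Sum>i\<in>I. Z \<tau> i \<omega>) - b < \<eta>"
        using neg \<omega> by (auto simp: R_def not_le)
      have "(\<Sum>i\<in>I. U i \<omega> - Z \<tau> i \<omega>) \<le> 1 - \<eta>"
      proof (cases "\<exists>i\<in>I. U i \<omega> > \<tau>")
        case True
        then obtain i where i: "i \<in> I" "U i \<omega> > \<tau>" by blast
        have "(\<Sum>j\<in>I. U j \<omega> - Z \<tau> j \<omega>) = (U i \<omega> - Z \<tau> i \<omega>) + (\<Sum>j\<in>I - {i}. U j \<omega> - Z \<tau> j \<omega>)"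
          using finite_I i by (simp add: sum.remove)
        also have "(\<Sum>j\<in>I - {i}. U j \<omega> - Z \<tau> j \<omega>) = 0"
        proof (intro sum.neutral ballI)
          fix j assume "j \<in> I - {i}"
          then have "\<not> U j \<omega> > \<tau>" using uniq[of i j] i by auto
          then show "U j \<omega> - Z \<tau> j \<omega> = 0" by (simp add: Z_def)
        qed
        finally show ?thesis using i le[of i] by (simp add: Z_def)
      next
        case False
        then have "(\<Sum>j\<in>I. U j \<omega> - Z \<tau> j \<omega>) = 0"
          by (intro sum.neutral) (auto simp: Z_def)
        then show ?thesis using \<eta> by simp
      qed
      then show False using Zlt \<omega> by (simp add: sum_subtractf)
    qed
  qed
  then have "prob {\<omega> \<in> space M. (\<Sum>i\<in>I. U i \<omega>) - b > 1}
      \<le> prob ((\<Union>i\<in>I. A i) \<union> (\<Union>(i, j)\<in>P. T j \<inter> T i) \<union> R)"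
    using AI TP by (intro finite_measure_mono) auto
  also have "\<dots> \<le> prob (\<Union>i\<in>I. A i) + prob (\<Union>(i, j)\<in>P. T j \<inter> T i) + prob R"
    using AI TP by (intro order_trans[OF measure_Un_le] add_right_mono) auto
  also have "prob (\<Union>i\<in>I. A i) \<le> (\<Sum>i\<in>I. prob (A i))"
    using finite_I by (intro finite_measure_subadditive_finite) auto
  also have "prob (\<Union>(i, j)\<in>P. T j \<inter> T i) \<le> (\<Sum>(i, j)\<in>P. prob (T j \<inter> T i))"
    unfolding case_prod_unfold using P by (intro finite_measure_subadditive_finite) auto
  also have "\<dots> = (\<Sum>(i, j)\<in>P. prob (T j) * prob (T i))"
    unfolding T_def by (intro sum.cong refl) (auto simp: P_def prob_tail_Int_tail)
  \<comment> \<open>Independence needs distinct indices, so the diagonal enters only now; with it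
    the sum over ordered pairs is a perfect square.\<close>
  also have "\<dots> \<le> (\<Sum>(i, j)\<in>I \<times> I. prob (T j) * prob (T i))"
    using P finite_I by (intro sum_mono2) auto
  also have "\<dots> = (\<Sum>i\<in>I. prob (T i))\<^sup>2"
    by (simp add: sum.cartesian_product[symmetric] power2_eq_square sum_product mult.commute)
  also have "\<dots> \<le> (K * D * \<tau> powr - \<beta>)\<^sup>2"
    unfolding T_def using \<tau> by (intro power_mono sum_tail_le sum_nonneg) auto
  finally show ?thesis by (simp add: A_def R_def)
qed

text \<open>The events that the \<open>j\<close>-th summand alone is large, while the others do not pull the sum
  down, are pairwise disjoint, so no inclusion-exclusion is needed.\<close>

lemma prob_sum_gt_ge:
  assumes \<eta>: "0 < \<eta>"
    and \<rho>: "\<And>j. j \<in> I \<Longrightarrow> prob {\<omega> \<in> space M. (\<Sum>i\<in>I - {j}. U i \<omega>) - b \<le> - \<eta>} \<le> \<rho>"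
  shows "prob {\<omega> \<in> space M. (\<Sum>i\<in>I. U i \<omega>) - b > 1}
    \<ge> (\<Sum>j\<in>I. prob {\<omega> \<in> space M. U j \<omega> > 1 + \<eta>} * (1 - \<rho> - K * D * (1 + \<eta>) powr - \<beta>))"
proof -
  define A where "A i = {\<omega> \<in> space M. U i \<omega> > 1 + \<eta>}" for i
  define H where "H j = {\<omega> \<in> space M. (\<Sum>i\<in>I - {j}. U i \<omega>) \<in> {b - \<eta><..}}" for j
  \<comment> \<open>\<open>H j\<close> and each \<open>A i\<close> with i distinct from j are
    independent of \<open>A j\<close>. What is lost between \<open>A j\<close> and
    \<open>B j\<close> is therefore a fraction of \<open>prob (A j)\<close>, which keeps the final
    error proportional to \<open>D\<close>.\<close>
  define B where "B j = A j \<inter> H j - (\<Union>i\<in>I - {j}. A i)" for j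
  have [measurable]: "A i \<in> events" if "i \<in> I" for i
    unfolding A_def using that by measurable
  have [measurable]: "H j \<in> events" for j
    unfolding H_def by measurable
  have Bev[measurable]: "B j \<in> events" if "j \<in> I" for j
    unfolding B_def using that finite_I by (intro sets.Diff sets.Int sets.finite_UN) measurable
  have Bprob: "prob (A j) * (1 - \<rho> - K * D * (1 + \<eta>) powr - \<beta>) \<le> prob (B j)" if j: "j \<in> I" for j
  proof -
    have "space M - H j = {\<omega> \<in> space M. (\<Sum>i\<in>I - {j}. U i \<omega>) - b \<le> - \<eta>}"
      by (auto simp: H_def not_less)
    then have H: "1 - \<rho> \<le> prob (H j)"
      using prob_compl[of "H j"] \<rho>[OF j] by simp
    have "prob (A j) * prob (H j) = prob (A j \<inter> H j)"
      unfolding A_def H_def using j by (subst prob_tail_Int_sum) auto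
    also have "\<dots> \<le> prob (B j \<union> (\<Union>i\<in>I - {j}. A j \<inter> A i))"
    proof (rule finite_measure_mono)
      show "A j \<inter> H j \<subseteq> B j \<union> (\<Union>i\<in>I - {j}. A j \<inter> A i)"
        by (auto simp: B_def)
    qed (use j finite_I in \<open>(intro sets.Un sets.finite_UN; auto)\<close>)
    also have "\<dots> \<le> prob (B j) + prob (\<Union>i\<in>I - {j}. A j \<inter> A i)"
      using j finite_I by (intro measure_Un_le sets.finite_UN) auto
    also have "prob (\<Union>i\<in>I - {j}. A j \<inter> A i) \<le> (\<Sum>i\<in>I - {j}. prob (A j \<inter> A i))"
      using j finite_I by (intro finite_measure_subadditive_finite) auto
    also have "\<dots> = (\<Sum>i\<in>I - {j}. prob (A j) * prob (A i))"
      unfolding A_def using j by (intro sum.cong refl prob_tail_Int_tail) auto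
    also have "\<dots> = prob (A j) * (\<Sum>i\<in>I - {j}. prob (A i))"
      by (simp add: sum_distrib_left)
    also have "\<dots> \<le> prob (A j) * (K * D * (1 + \<eta>) powr - \<beta>)"
      unfolding A_def using \<eta> by (intro mult_left_mono sum_tail_le) auto
    finally have "prob (A j) * prob (H j) \<le> prob (B j) + prob (A j) * (K * D * (1 + \<eta>) powr - \<beta>)"
      by simp
    moreover have "prob (A j) * (1 - \<rho>) \<le> prob (A j) * prob (H j)"
      using H by (intro mult_left_mono) auto
    ultimately show ?thesis by (simp add: algebra_simps)
  qed
  have "(\<Sum>j\<in>I. prob (A j) * (1 - \<rho> - K * D * (1 + \<eta>) powr - \<beta>)) \<le> (\<Sum>j\<in>I. prob (B j))"
    by (intro sum_mono Bprob)
  also have "\<dots> = prob (\<Union>j\<in>I. B j)"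
  proof (rule finite_measure_finite_Union[symmetric])
    show "disjoint_family_on B I"
      by (auto simp: disjoint_family_on_def B_def)
  qed (use finite_I in auto)
  also have "\<dots> \<le> prob {\<omega> \<in> space M. (\<Sum>i\<in>I. U i \<omega>) - b > 1}"
  proof (rule finite_measure_mono)
    show "(\<Union>j\<in>I. B j) \<subseteq> {\<omega> \<in> space M. (\<Sum>i\<in>I. U i \<omega>) - b > 1}"
      using finite_I by (auto simp: B_def A_def H_def sum.remove)
  qed measurable
  finally show ?thesis by (simp add: A_def)
qed

text \<open>This is \<open>centering\<close> divided by the level x, the unit in which the
  \<open>U i\<close> are measured.\<close>

definition center :: real where
  "center = (if \<beta> < 1 then 0 else \<Sum>i\<in>I. expectation (U i))"

text \<open>The truncated mean lies below \<open>center\<close>, so the bias helps in this direction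
  and Chebyshev applies with the whole of \<eta>.\<close>

lemma prob_Z_gt_center:
  assumes "1 < \<beta>" "\<beta> < 2" "0 < \<tau>" "0 < \<eta>"
  shows "prob {\<omega> \<in> space M. (\<Sum>i\<in>I. Z \<tau> i \<omega>) - center \<ge> \<eta>}
    \<le> K * D * trunc_const \<beta> 2 * \<tau> powr (2 - \<beta>) / \<eta>\<^sup>2"
proof -
  have "(\<Sum>i\<in>I. expectation (Z \<tau> i)) \<le> (\<Sum>i\<in>I. expectation (U i))"
    using assms integrable_Z integrable_U Z_bounds by (intro sum_mono integral_mono) auto
  then have "prob {\<omega> \<in> space M. (\<Sum>i\<in>I. Z \<tau> i \<omega>) - center \<ge> \<eta>}
    \<le> prob {\<omega> \<in> space M. \<bar>(\<Sum>i\<in>I. Z \<tau> i \<omega>) - (\<Sum>i\<in>I. expectation (Z \<tau> i))\<bar> \<ge> \<eta>}"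
    using assms by (intro finite_measure_mono) (auto simp: center_def)
  also have "\<dots> \<le> K * D * trunc_const \<beta> 2 * \<tau> powr (2 - \<beta>) / \<eta>\<^sup>2"
    using assms by (intro Z_deviation_le) auto
  finally show ?thesis .
qed

text \<open>In this direction the bias hurts. \<open>center\<close> exceeds the truncated mean of
  the remaining summands by at most \<tau>, for the removed one, plus the exceedance means. The
  condition \<open>small\<close> limits this to \<eta>/2 and leaves \<eta>/2 for Chebyshev.\<close>

lemma prob_sum_remove_le_center:
  assumes "1 < \<beta>" "\<beta> < 2" "0 < \<tau>" "0 < \<eta>" and j: "j \<in> I"
    and small: "\<tau> + K * D * exceed_const \<beta> * \<tau> powr (1 - \<beta>) \<le> \<eta> / 2"
  shows "prob {\<omega> \<in> space M. (\<Sum>i\<in>I - {j}. U i \<omega>) - center \<le> - \<eta>}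
    \<le> K * D * trunc_const \<beta> 2 * \<tau> powr (2 - \<beta>) / (\<eta> / 2)\<^sup>2"
proof -
  have "center \<le> (\<Sum>i\<in>I. expectation (Z \<tau> i) + K * w i * exceed_const \<beta> * \<tau> powr (1 - \<beta>))"
    using assms by (auto simp: center_def intro!: sum_mono expectation_U_le)
  also have "\<dots> = expectation (Z \<tau> j) + (\<Sum>i\<in>I - {j}. expectation (Z \<tau> i))
      + K * D * exceed_const \<beta> * \<tau> powr (1 - \<beta>)"
    using j finite_I
    by (simp add: sum.distrib D_def sum_distrib_left sum_distrib_right
        sum.remove[of I j "\<lambda>i. expectation (Z \<tau> i)"])
  also have "expectation (Z \<tau> j) \<le> expectation (\<lambda>_. \<tau>)"
    using assms integrable_Z Z_bounds by (intro integral_mono) auto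
  finally have center: "center \<le> (\<Sum>i\<in>I - {j}. expectation (Z \<tau> i)) + \<eta> / 2"
    using small by (simp add: prob_space)
  have ZU: "(\<Sum>i\<in>I - {j}. Z \<tau> i \<omega>) \<le> (\<Sum>i\<in>I - {j}. U i \<omega>)" for \<omega>
    using assms Z_bounds by (intro sum_mono) auto
  have "prob {\<omega> \<in> space M. (\<Sum>i\<in>I - {j}. U i \<omega>) - center \<le> - \<eta>}
    \<le> prob {\<omega> \<in> space M. \<bar>(\<Sum>i\<in>I - {j}. Z \<tau> i \<omega>) - (\<Sum>i\<in>I - {j}. expectation (Z \<tau> i))\<bar> \<ge> \<eta> / 2}"
  proof (intro finite_measure_mono subsetI)
    fix \<omega> assume "\<omega> \<in> {\<omega> \<in> space M. (\<Sum>i\<in>I - {j}. U i \<omega>) - center \<le> - \<eta>}"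
    then show "\<omega> \<in> {\<omega> \<in> space M. \<bar>(\<Sum>i\<in>I - {j}. Z \<tau> i \<omega>) - (\<Sum>i\<in>I - {j}. expectation (Z \<tau> i))\<bar> \<ge> \<eta> / 2}"
      using center ZU[of \<omega>] unfolding mem_Collect_eq by linarith
  qed measurable
  also have "\<dots> \<le> K * D * trunc_const \<beta> 2 * \<tau> powr (2 - \<beta>) / (\<eta> / 2)\<^sup>2"
    using assms by (intro Z_deviation_le) auto
  finally show ?thesis .
qed

end

section \<open>Choice of the parameters\<close>

lemma eventually_mult_le_at_right_0:
  fixes a e :: real
  assumes "0 < e"
  shows "\<forall>\<^sub>F \<delta> in at_right 0. a * \<delta> \<le> e"
proof -
  have "((\<lambda>\<delta>. a * \<delta>) \<longlongrightarrow> a * 0) (at_right 0)"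
    by (intro tendsto_intros)
  then have "\<forall>\<^sub>F \<delta> in at_right 0. a * \<delta> < e"
    using assms by (intro order_tendstoD(2)[where y = "a * 0"]) auto
  then show ?thesis by eventually_elim simp
qed

lemma eventually_mult_powr_le_at_right_0:
  fixes a e p :: real
  assumes "0 < e" "0 < p"
  shows "\<forall>\<^sub>F \<tau> in at_right 0. a * \<tau> powr p \<le> e"
proof -
  have "((\<lambda>\<tau>. \<tau> powr p) \<longlongrightarrow> 0) (at_right (0::real))"
    using assms(2) by real_asymp
  then have "((\<lambda>\<tau>. a * \<tau> powr p) \<longlongrightarrow> a * 0) (at_right 0)"
    by (intro tendsto_intros)
  then have "\<forall>\<^sub>F \<tau> in at_right 0. a * \<tau> powr p < e"
    using assms by (intro order_tendstoD(2)[where y = "a * 0"]) auto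
  then show ?thesis by eventually_elim simp
qed

text \<open>The order of choice is forced. \<eta> comes from continuity at 0. Then \<tau> makes the
  Markov and Chebyshev terms small although \<eta> sits in their denominators; the Markov term has a
  positive exponent only for \<beta> < 1. Finally \<delta> compensates the negative powers of
  \<tau>.\<close>

lemma one_big_jump_parameters:
  fixes \<beta> c K \<epsilon> :: real
  assumes \<beta>: "\<beta> \<in> {0<..<2} - {1}" and c: "0 < c" and \<epsilon>: "0 < \<epsilon>"
  obtains \<eta> \<tau> \<delta> where "0 < \<eta>" "\<eta> < 1" "\<eta> < c" "0 < \<tau>" "0 < \<delta>"
    "(c + \<eta>) * (1 - \<eta>) powr - \<beta> \<le> c + \<epsilon> / 3"
    "c - \<epsilon> / 2 \<le> (c - \<eta>) * (1 + \<eta>) powr - \<beta>"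
    "\<beta> < 1 \<Longrightarrow> K * trunc_const \<beta> 1 * \<tau> powr (1 - \<beta>) / \<eta> \<le> \<epsilon> / 3"
    "K * trunc_const \<beta> 2 * \<tau> powr (2 - \<beta>) / \<eta>\<^sup>2 \<le> \<epsilon> / 3"
    "(K * \<tau> powr - \<beta>)\<^sup>2 * \<delta> \<le> \<epsilon> / 3"
    "\<tau> + (K * exceed_const \<beta> * \<tau> powr (1 - \<beta>)) * \<delta> \<le> \<eta> / 2"
    "(K + K * trunc_const \<beta> 2 * \<tau> powr (2 - \<beta>) / (\<eta> / 2)\<^sup>2) * \<delta> \<le> min 1 (\<epsilon> / (2 * c))"
proof -
  have "((\<lambda>\<eta>. (c + \<eta>) * (1 - \<eta>) powr - \<beta>) \<longlongrightarrow> (c + 0) * (1 - 0) powr - \<beta>) (at_right 0)"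
    by (intro tendsto_intros) auto
  then have 1: "\<forall>\<^sub>F \<eta> in at_right 0. (c + \<eta>) * (1 - \<eta>) powr - \<beta> < c + \<epsilon> / 3"
    using \<epsilon> by (intro order_tendstoD(2)) auto
  have "((\<lambda>\<eta>. (c - \<eta>) * (1 + \<eta>) powr - \<beta>) \<longlongrightarrow> (c - 0) * (1 + 0) powr - \<beta>) (at_right 0)"
    by (intro tendsto_intros) auto
  then have 2: "\<forall>\<^sub>F \<eta> in at_right 0. c - \<epsilon> / 2 < (c - \<eta>) * (1 + \<eta>) powr - \<beta>"
    using \<epsilon> by (intro order_tendstoD(1)) auto
  have 3: "\<forall>\<^sub>F \<eta> in at_right (0::real). \<eta> \<in> {0<..<min 1 c}"
    using c by (intro eventually_at_right_real) auto
  obtain \<eta> where \<eta>: "(c + \<eta>) * (1 - \<eta>) powr - \<beta> < c + \<epsilon> / 3"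
    "c - \<epsilon> / 2 < (c - \<eta>) * (1 + \<eta>) powr - \<beta>" "\<eta> \<in> {0<..<min 1 c}"
    using eventually_happens'[OF trivial_limit_at_right_real
        eventually_conj[OF 1 eventually_conj[OF 2 3]]] by blast
  have 4: "\<forall>\<^sub>F \<tau> in at_right 0. \<beta> < 1 \<longrightarrow> (K * trunc_const \<beta> 1 / \<eta>) * \<tau> powr (1 - \<beta>) \<le> \<epsilon> / 3"
    using eventually_mult_powr_le_at_right_0[of "\<epsilon> / 3" "1 - \<beta>" "K * trunc_const \<beta> 1 / \<eta>"] \<epsilon>
    by (cases "\<beta> < 1") simp_all
  have 5: "\<forall>\<^sub>F \<tau> in at_right 0. (K * trunc_const \<beta> 2 / \<eta>\<^sup>2) * \<tau> powr (2 - \<beta>) \<le> \<epsilon> / 3"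
    using \<epsilon> \<beta> by (intro eventually_mult_powr_le_at_right_0) auto
  \<comment> \<open>A quarter of \<eta> goes to \<tau> and another quarter to the exceedance term
    below, which together meet the bound \<eta>/2.\<close>
  have 6: "\<forall>\<^sub>F \<tau> in at_right (0::real). \<tau> \<in> {0<..<\<eta> / 4}"
    using \<eta> by (intro eventually_at_right_real) auto
  obtain \<tau> where \<tau>: "\<beta> < 1 \<longrightarrow> (K * trunc_const \<beta> 1 / \<eta>) * \<tau> powr (1 - \<beta>) \<le> \<epsilon> / 3"
    "(K * trunc_const \<beta> 2 / \<eta>\<^sup>2) * \<tau> powr (2 - \<beta>) \<le> \<epsilon> / 3" "\<tau> \<in> {0<..<\<eta> / 4}"
    using eventually_happens'[OF trivial_limit_at_right_real
        eventually_conj[OF 4 eventually_conj[OF 5 6]]] by blast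
  have 7: "\<forall>\<^sub>F \<delta> in at_right 0. (K * \<tau> powr - \<beta>)\<^sup>2 * \<delta> \<le> \<epsilon> / 3"
    using \<epsilon> by (intro eventually_mult_le_at_right_0) auto
  have 8: "\<forall>\<^sub>F \<delta> in at_right 0. (K * exceed_const \<beta> * \<tau> powr (1 - \<beta>)) * \<delta> \<le> \<eta> / 4"
    using \<eta> by (intro eventually_mult_le_at_right_0) auto
  have 9: "\<forall>\<^sub>F \<delta> in at_right 0.
      (K + K * trunc_const \<beta> 2 * \<tau> powr (2 - \<beta>) / (\<eta> / 2)\<^sup>2) * \<delta> \<le> min 1 (\<epsilon> / (2 * c))"
    using \<epsilon> c by (intro eventually_mult_le_at_right_0) auto
  obtain \<delta> where \<delta>: "(K * \<tau> powr - \<beta>)\<^sup>2 * \<delta> \<le> \<epsilon> / 3"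
    "(K * exceed_const \<beta> * \<tau> powr (1 - \<beta>)) * \<delta> \<le> \<eta> / 4"
    "(K + K * trunc_const \<beta> 2 * \<tau> powr (2 - \<beta>) / (\<eta> / 2)\<^sup>2) * \<delta> \<le> min 1 (\<epsilon> / (2 * c))"
    "0 < \<delta>"
    using eventually_happens'[OF trivial_limit_at_right_real eventually_conj[OF 7
        eventually_conj[OF 8 eventually_conj[OF 9 eventually_at_right_less]]]] by blast
  show thesis
    using \<eta> \<tau> \<delta> by (intro that[of \<eta> \<tau> \<delta>]) auto
qed

section \<open>Upper and lower bound for the probability of a large sum\<close>

lemma (in heavy_sum) one_big_jump_le:
  assumes \<beta>: "\<beta> \<in> {0<..<2} - {1}"
    and \<eta>: "0 < \<eta>" "\<eta> < 1" and \<tau>: "0 < \<tau>" and D: "D \<le> \<delta>"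
    and tail_ub: "\<And>i. i \<in> I \<Longrightarrow>
      prob {\<omega> \<in> space M. U i \<omega> > 1 - \<eta>} \<le> (c + \<eta>) * w i * (1 - \<eta>) powr - \<beta>"
    and p1: "(c + \<eta>) * (1 - \<eta>) powr - \<beta> \<le> c + \<epsilon> / 3"
    and p2: "\<beta> < 1 \<Longrightarrow> K * trunc_const \<beta> 1 * \<tau> powr (1 - \<beta>) / \<eta> \<le> \<epsilon> / 3"
    and p3: "K * trunc_const \<beta> 2 * \<tau> powr (2 - \<beta>) / \<eta>\<^sup>2 \<le> \<epsilon> / 3"
    and p4: "(K * \<tau> powr - \<beta>)\<^sup>2 * \<delta> \<le> \<epsilon> / 3"
  shows "prob {\<omega> \<in> space M. (\<Sum>i\<in>I. U i \<omega>) - center > 1} \<le> (c + \<epsilon>) * D"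
proof -
  have "(\<Sum>i\<in>I. prob {\<omega> \<in> space M. U i \<omega> > 1 - \<eta>}) \<le> (\<Sum>i\<in>I. (c + \<eta>) * w i * (1 - \<eta>) powr - \<beta>)"
    by (intro sum_mono tail_ub)
  also have "\<dots> = ((c + \<eta>) * (1 - \<eta>) powr - \<beta>) * D"
    by (simp add: D_def sum_distrib_left sum_distrib_right mult_ac)
  also have "\<dots> \<le> (c + \<epsilon> / 3) * D"
    using p1 D_nonneg by (rule mult_right_mono)
  finally have 1: "(\<Sum>i\<in>I. prob {\<omega> \<in> space M. U i \<omega> > 1 - \<eta>}) \<le> (c + \<epsilon> / 3) * D" .
  \<comment> \<open>Only one of the two factors \<open>D\<close> is traded for \<delta>; the other
    keeps the pair term proportional to \<open>D\<close>.\<close>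
  have "(K * D * \<tau> powr - \<beta>)\<^sup>2 = ((K * \<tau> powr - \<beta>)\<^sup>2 * D) * D"
    by (simp add: power2_eq_square mult_ac)
  also have "\<dots> \<le> ((K * \<tau> powr - \<beta>)\<^sup>2 * \<delta>) * D"
    using D D_nonneg by (intro mult_right_mono mult_left_mono) auto
  also have "\<dots> \<le> \<epsilon> / 3 * D"
    using p4 D_nonneg by (rule mult_right_mono)
  finally have 2: "(K * D * \<tau> powr - \<beta>)\<^sup>2 \<le> \<epsilon> / 3 * D" .
  have 3: "prob {\<omega> \<in> space M. (\<Sum>i\<in>I. Z \<tau> i \<omega>) - center \<ge> \<eta>} \<le> \<epsilon> / 3 * D"
  proof (cases "\<beta> < 1")
    case True
    then have "prob {\<omega> \<in> space M. (\<Sum>i\<in>I. Z \<tau> i \<omega>) - center \<ge> \<eta>}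
        \<le> (K * trunc_const \<beta> 1 * \<tau> powr (1 - \<beta>) / \<eta>) * D"
      using Z_sum_Markov[OF True \<tau> \<eta>(1)] by (simp add: center_def mult_ac)
    also have "\<dots> \<le> \<epsilon> / 3 * D"
      using p2[OF True] D_nonneg by (rule mult_right_mono)
    finally show ?thesis .
  next
    case False
    then have "prob {\<omega> \<in> space M. (\<Sum>i\<in>I. Z \<tau> i \<omega>) - center \<ge> \<eta>}
        \<le> (K * trunc_const \<beta> 2 * \<tau> powr (2 - \<beta>) / \<eta>\<^sup>2) * D"
      using prob_Z_gt_center[of \<tau> \<eta>] \<beta> \<tau> \<eta> by (simp add: mult_ac)
    also have "\<dots> \<le> \<epsilon> / 3 * D"
      using p3 D_nonneg by (rule mult_right_mono)
    finally show ?thesis .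
  qed
  show ?thesis
    using prob_sum_gt_le[OF \<tau> \<eta>, of center] 1 2 3 by (simp add: algebra_simps)
qed

text \<open>Half of \<epsilon> pays for using the tail at 1 + \<eta> with constant c - \<eta>, the
  other half for the fraction lost to the remaining summands.\<close>

lemma (in heavy_sum) one_big_jump_ge:
  assumes \<beta>: "\<beta> \<in> {0<..<2} - {1}" and c: "0 < c" and \<epsilon>: "0 < \<epsilon>"
    and \<eta>: "0 < \<eta>" "\<eta> < 1" "\<eta> < c" and \<tau>: "0 < \<tau>" and D: "D \<le> \<delta>"
    and tail_lb: "\<And>i. i \<in> I \<Longrightarrow>
      (c - \<eta>) * w i * (1 + \<eta>) powr - \<beta> \<le> prob {\<omega> \<in> space M. U i \<omega> > 1 + \<eta>}"
    and p1: "c - \<epsilon> / 2 \<le> (c - \<eta>) * (1 + \<eta>) powr - \<beta>"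
    and p2: "\<tau> + (K * exceed_const \<beta> * \<tau> powr (1 - \<beta>)) * \<delta> \<le> \<eta> / 2"
    and p3: "(K + K * trunc_const \<beta> 2 * \<tau> powr (2 - \<beta>) / (\<eta> / 2)\<^sup>2) * \<delta> \<le> min 1 (\<epsilon> / (2 * c))"
  shows "(c - \<epsilon>) * D \<le> prob {\<omega> \<in> space M. (\<Sum>i\<in>I. U i \<omega>) - center > 1}"
proof -
  define \<rho> where "\<rho> = K * D * trunc_const \<beta> 2 * \<tau> powr (2 - \<beta>) / (\<eta> / 2)\<^sup>2"
  \<comment> \<open>\<sigma> dominates the total lost fraction, with
    \<open>(1 + \<eta>) powr - \<beta>\<close> estimated by 1. In \<open>p3\<close>, the bound 1
    keeps \<open>1 - \<sigma>\<close> nonnegative, so that it can multiply the tail inequalities,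
    and \<open>\<epsilon> / (2 * c)\<close> makes \<open>c * \<sigma>\<close> at most
    \<epsilon>/2.\<close>
  define \<sigma> where "\<sigma> = (K + K * trunc_const \<beta> 2 * \<tau> powr (2 - \<beta>) / (\<eta> / 2)\<^sup>2) * D"
  define q where "q = (c - \<eta>) * (1 + \<eta>) powr - \<beta>"
  have tc: "0 \<le> trunc_const \<beta> 2"
    using \<beta> by (intro less_imp_le trunc_const_pos) auto
  have \<rho>0: "0 \<le> \<rho>"
    unfolding \<rho>_def using K_nonneg D_nonneg tc by simp
  have p1': "(1 + \<eta>) powr - \<beta> \<le> 1"
    using \<eta> \<beta> powr_mono[of "- \<beta>" 0 "1 + \<eta>"] by simp
  have "K * D * (1 + \<eta>) powr - \<beta> \<le> K * D"
    using p1' K_nonneg D_nonneg by (intro mult_left_le) auto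
  then have \<sigma>: "1 - \<sigma> \<le> 1 - \<rho> - K * D * (1 + \<eta>) powr - \<beta>"
    by (simp add: \<sigma>_def \<rho>_def algebra_simps)
  have "\<sigma> \<le> (K + K * trunc_const \<beta> 2 * \<tau> powr (2 - \<beta>) / (\<eta> / 2)\<^sup>2) * \<delta>"
    unfolding \<sigma>_def using D K_nonneg tc by (intro mult_left_mono) auto
  then have \<sigma>1: "\<sigma> \<le> 1" and "\<sigma> \<le> \<epsilon> / (2 * c)"
    using p3 by linarith+
  then have \<sigma>c: "c * \<sigma> \<le> \<epsilon> / 2"
    using c by (simp add: field_simps)
  have \<sigma>0: "0 \<le> \<sigma>"
    unfolding \<sigma>_def using K_nonneg D_nonneg tc by simp
  have "q \<le> (c - \<eta>) * 1"
    unfolding q_def using \<eta> p1' by (intro mult_left_mono) auto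
  then have "q * \<sigma> \<le> c * \<sigma>"
    using \<sigma>0 \<eta> by (intro mult_right_mono) auto
  then have q: "c - \<epsilon> \<le> q * (1 - \<sigma>)"
    using \<sigma>c p1 by (simp add: q_def[symmetric] right_diff_distrib)
  have \<rho>: "prob {\<omega> \<in> space M. (\<Sum>i\<in>I - {j}. U i \<omega>) - center \<le> - \<eta>} \<le> \<rho>" if j: "j \<in> I" for j
  proof (cases "\<beta> < 1")
    case True
    have "0 \<le> (\<Sum>i\<in>I - {j}. U i \<omega>)" for \<omega>
      using nonneg by (intro sum_nonneg) auto
    then have empty: "{\<omega> \<in> space M. (\<Sum>i\<in>I - {j}. U i \<omega>) - center \<le> - \<eta>} = {}"
      using True \<eta> by (auto simp: center_def not_le intro: less_le_trans[of _ 0])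
    show ?thesis unfolding empty using \<rho>0 by simp
  next
    case False
    then have \<beta>1: "1 < \<beta>" using \<beta> by auto
    have "K * D * exceed_const \<beta> * \<tau> powr (1 - \<beta>) = (K * exceed_const \<beta> * \<tau> powr (1 - \<beta>)) * D"
      by simp
    also have "\<dots> \<le> (K * exceed_const \<beta> * \<tau> powr (1 - \<beta>)) * \<delta>"
      using D K_nonneg exceed_const_pos[OF \<beta>1] by (intro mult_left_mono) auto
    finally show ?thesis
      unfolding \<rho>_def using p2 \<beta> \<beta>1 \<tau> \<eta> j by (intro prob_sum_remove_le_center) auto
  qed
  have "(c - \<epsilon>) * D \<le> (q * (1 - \<sigma>)) * D"
    using q D_nonneg by (rule mult_right_mono)
  also have "\<dots> = (\<Sum>j\<in>I. (q * w j) * (1 - \<sigma>))"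
    by (simp add: D_def sum_distrib_left mult_ac)
  also have "\<dots> \<le> (\<Sum>j\<in>I. prob {\<omega> \<in> space M. U j \<omega> > 1 + \<eta>} * (1 - \<rho> - K * D * (1 + \<eta>) powr - \<beta>))"
  proof (rule sum_mono)
    fix j assume j: "j \<in> I"
    have "q * w j \<le> prob {\<omega> \<in> space M. U j \<omega> > 1 + \<eta>}"
      using tail_lb[OF j] by (simp add: q_def mult_ac)
    then show "q * w j * (1 - \<sigma>)
        \<le> prob {\<omega> \<in> space M. U j \<omega> > 1 + \<eta>} * (1 - \<rho> - K * D * (1 + \<eta>) powr - \<beta>)"
      using \<sigma> \<sigma>1 by (intro mult_mono) auto
  qed
  also have "\<dots> \<le> prob {\<omega> \<in> space M. (\<Sum>i\<in>I. U i \<omega>) - center > 1}"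
    by (rule prob_sum_gt_ge[OF \<eta>(1) \<rho>])
  finally show ?thesis .
qed

section \<open>From the sums S_n to rescaled summands\<close>

text \<open>Passing from n to \<open>Suc n\<close> adds \<open>Y_proc m X (Suc n)\<close>, which
  raises the weight of each earlier \<open>X j\<close> by its next coefficient and starts the new
  one with weight m_0.\<close>

lemma S_proc_eq_weighted_sum:
  "S_proc m X n \<omega> = (\<Sum>j=1..n. (\<Sum>i=0..n - j. m i) * X j \<omega>)"
proof (induction n)
  case (Suc n)
  have "(\<Sum>j=1..n. (\<Sum>i=0..Suc n - j. m i) * X j \<omega>)
      = (\<Sum>j=1..n. (\<Sum>i=0..n - j. m i) * X j \<omega>) + (\<Sum>j=1..n. m (Suc n - j) * X j \<omega>)"
    by (simp add: sum.distrib[symmetric] Suc_diff_le distrib_right)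
  then show ?case
    using Suc by (simp add: S_proc_def Y_proc_def)
qed (simp add: S_proc_def)

text \<open>The asymptotics are turned into the two inequalities that the estimates consume. The
  crude one must hold for every positive x, because the dyadic shells reach down to arbitrarily
  small levels.\<close>

lemma tail_power_law:
  fixes Z :: "'a \<Rightarrow> real"
  assumes "prob_space M" and c: "0 < c" and \<beta>: "0 < \<beta>"
    and equiv: "tail_prob M Z \<sim>[at_top] (\<lambda>x. c * x powr - \<beta>)"
  shows eventually_tail_near: "0 < \<eta> \<Longrightarrow>
      \<exists>y>0. \<forall>x\<ge>y. \<bar>tail_prob M Z x - c * x powr - \<beta>\<bar> \<le> \<eta> * x powr - \<beta>"
    and tail_bounded: "\<exists>K\<ge>0. \<forall>x>0. tail_prob M Z x \<le> K * x powr - \<beta>"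
proof -
  show near: "\<exists>y>0. \<forall>x\<ge>y. \<bar>tail_prob M Z x - c * x powr - \<beta>\<bar> \<le> \<eta> * x powr - \<beta>"
    if "0 < \<eta>" for \<eta>
  proof -
    have "((\<lambda>x. tail_prob M Z x / (c * x powr - \<beta>)) \<longlongrightarrow> 1) at_top"
    proof (rule asymp_equivD_strong[OF equiv])
      show "\<forall>\<^sub>F x in at_top. tail_prob M Z x \<noteq> 0 \<or> c * x powr - \<beta> \<noteq> 0"
        using eventually_gt_at_top[of 0] by eventually_elim (use c in simp)
    qed
    then have "\<forall>\<^sub>F x in at_top. dist (tail_prob M Z x / (c * x powr - \<beta>)) 1 < \<eta> / c"
      using that c by (intro tendstoD) auto
    then obtain y where y: "\<And>x. x \<ge> y \<Longrightarrow> dist (tail_prob M Z x / (c * x powr - \<beta>)) 1 < \<eta> / c"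
      unfolding eventually_at_top_linorder by blast
    have "\<bar>tail_prob M Z x - c * x powr - \<beta>\<bar> \<le> \<eta> * x powr - \<beta>" if "x \<ge> max y 1" for x
    proof -
      have x: "0 < x powr - \<beta>" "x \<ge> y" using that by auto
      have "tail_prob M Z x - c * x powr - \<beta>
          = (tail_prob M Z x / (c * x powr - \<beta>) - 1) * (c * x powr - \<beta>)"
        using x c by (simp add: field_simps)
      then have "\<bar>tail_prob M Z x - c * x powr - \<beta>\<bar>
          = \<bar>tail_prob M Z x / (c * x powr - \<beta>) - 1\<bar> * (c * x powr - \<beta>)"
        using x c by (simp add: abs_mult)
      also have "\<dots> \<le> (\<eta> / c) * (c * x powr - \<beta>)"
        using y[OF x(2)] x c by (intro mult_right_mono) (auto simp: dist_real_def)
      finally show ?thesis using c by simp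
    qed
    moreover have "0 < max y 1" by simp
    ultimately show ?thesis by blast
  qed
  obtain y where y: "y > 0" "\<And>x. x \<ge> y \<Longrightarrow> \<bar>tail_prob M Z x - c * x powr - \<beta>\<bar> \<le> 1 * x powr - \<beta>"
    using near[OF zero_less_one] by blast
  have "tail_prob M Z x \<le> max (c + 1) (y powr \<beta>) * x powr - \<beta>" if "x > 0" for x
  proof (cases "x \<ge> y")
    case True
    then have "tail_prob M Z x \<le> (c + 1) * x powr - \<beta>"
      using y(2)[of x] by (simp add: algebra_simps abs_le_iff)
    also have "\<dots> \<le> max (c + 1) (y powr \<beta>) * x powr - \<beta>"
      by (intro mult_right_mono) auto
    finally show ?thesis .
  next
    case False
    \<comment> \<open>Below y the trivial bound 1 suffices: it is at most (y/x)^\<beta>, whence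
      \<open>y powr \<beta>\<close> in the constant.\<close>
    have "tail_prob M Z x \<le> 1"
      unfolding tail_prob_def by (rule prob_space.prob_le_1[OF assms(1)])
    also have "1 = x powr \<beta> * x powr - \<beta>"
      using that by (simp add: powr_add[symmetric])
    also have "\<dots> \<le> max (c + 1) (y powr \<beta>) * x powr - \<beta>"
      using False that \<beta> by (intro mult_right_mono max.coboundedI2 powr_mono2) auto
    finally show ?thesis .
  qed
  moreover have "0 \<le> max (c + 1) (y powr \<beta>)"
    using c by (intro max.coboundedI1) simp
  ultimately show "\<exists>K\<ge>0. \<forall>x>0. tail_prob M Z x \<le> K * x powr - \<beta>"
    by blast
qed

lemma tail_prob_iid:
  assumes "prob_space M" "iid_seq M X" "j \<ge> 1"
  shows "tail_prob M (X j) x = tail_prob M (X 1) x"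
proof -
  have tail: "tail_prob M (X i) x = measure (distr M borel (X i)) {x<..}" if "i \<ge> 1" for i
  proof -
    have "X i \<in> borel_measurable M"
      using assms(2) that unfolding iid_seq_def prob_space.indep_vars_def[OF assms(1)] by auto
    then show ?thesis
      by (simp add: measure_distr tail_prob_def vimage_def Int_def conj_commute)
  qed
  have "distr M borel (X j) = distr M borel (X 1)"
    using assms(2,3) unfolding iid_seq_def by blast
  then show ?thesis
    using tail[OF assms(3)] tail[of 1] by simp
qed

text \<open>\<delta> is fixed before n and x. This is the source of the uniformity in the supremum,
  since \<open>L_seq \<beta> m n * x powr - \<beta>\<close> decreases in x.\<close>

lemma tail_prob_S_proc_near:
  fixes M :: "'a measure" and X :: "nat \<Rightarrow> 'a \<Rightarrow> real"
    and m :: "nat \<Rightarrow> real" and \<beta> :: real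
  assumes M: "prob_space M"
    and \<beta>: "\<beta> \<in> {0<..<2} - {1}"
    and iid: "iid_seq M X"
    and X_nonneg: "\<And>j. j \<ge> 1 \<Longrightarrow> AE \<omega> in M. X j \<omega> \<ge> 0"
    and c: "0 < c" and equiv: "tail_prob M (X 1) \<sim>[at_top] (\<lambda>x. c * x powr - \<beta>)"
    and m: "\<And>i. m i > 0"
    and \<epsilon>: "0 < \<epsilon>"
  shows "\<exists>\<delta>>0. \<forall>n x. 0 < x \<longrightarrow> L_seq \<beta> m n * x powr - \<beta> \<le> \<delta> \<longrightarrow>
    \<bar>tail_prob M (\<lambda>\<omega>. S_proc m X n \<omega> - centering M \<beta> m X n) x - c * (L_seq \<beta> m n * x powr - \<beta>)\<bar>
      \<le> \<epsilon> * (L_seq \<beta> m n * x powr - \<beta>)"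
proof -
  interpret prob_space M by (rule M)
  have \<beta>0: "0 < \<beta>" using \<beta> by auto
  obtain K where K: "K \<ge> 0" "\<And>x. x > 0 \<Longrightarrow> tail_prob M (X 1) x \<le> K * x powr - \<beta>"
    using tail_bounded[OF M c \<beta>0 equiv] by auto
  obtain \<eta> \<tau> \<delta> where p: "0 < \<eta>" "\<eta> < 1" "\<eta> < c" "0 < \<tau>" "0 < \<delta>"
    "(c + \<eta>) * (1 - \<eta>) powr - \<beta> \<le> c + \<epsilon> / 3"
    "c - \<epsilon> / 2 \<le> (c - \<eta>) * (1 + \<eta>) powr - \<beta>"
    "\<beta> < 1 \<Longrightarrow> K * trunc_const \<beta> 1 * \<tau> powr (1 - \<beta>) / \<eta> \<le> \<epsilon> / 3"
    "K * trunc_const \<beta> 2 * \<tau> powr (2 - \<beta>) / \<eta>\<^sup>2 \<le> \<epsilon> / 3"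
    "(K * \<tau> powr - \<beta>)\<^sup>2 * \<delta> \<le> \<epsilon> / 3"
    "\<tau> + (K * exceed_const \<beta> * \<tau> powr (1 - \<beta>)) * \<delta> \<le> \<eta> / 2"
    "(K + K * trunc_const \<beta> 2 * \<tau> powr (2 - \<beta>) / (\<eta> / 2)\<^sup>2) * \<delta> \<le> min 1 (\<epsilon> / (2 * c))"
    using one_big_jump_parameters[OF \<beta> c \<epsilon>, of K] by blast
  obtain y where y: "y > 0"
    "\<And>x. x \<ge> y \<Longrightarrow> \<bar>tail_prob M (X 1) x - c * x powr - \<beta>\<bar> \<le> \<eta> * x powr - \<beta>"
    using eventually_tail_near[OF M c \<beta>0 equiv p(1)] by auto
  \<comment> \<open>The second bound forces \<open>u j \<le> (1 - \<eta>) / y\<close>, via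
    \<open>w j \<le> D\<close>. Every level t \<ge> 1 - \<eta> for \<open>U j\<close> then
    corresponds to a level \<open>t / u j \<ge> y\<close> for X_1, where the sharp power law
    holds.\<close>
  define \<delta>' where "\<delta>' = min \<delta> (((1 - \<eta>) / y) powr \<beta>)"
  have "\<delta>' > 0" using p(2,5) y(1) by (simp add: \<delta>'_def)
  moreover have "\<bar>tail_prob M (\<lambda>\<omega>. S_proc m X n \<omega> - centering M \<beta> m X n) x
      - c * (L_seq \<beta> m n * x powr - \<beta>)\<bar> \<le> \<epsilon> * (L_seq \<beta> m n * x powr - \<beta>)"
    if x: "0 < x" and small: "L_seq \<beta> m n * x powr - \<beta> \<le> \<delta>'" for n x
  proof -
    define u where "u j = (\<Sum>i=0..n - j. m i) / x" for j
    define w where "w j = u j powr \<beta>" for j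
    \<comment> \<open>\<open>X j\<close> is nonnegative only almost surely, while the locale demands
      it pointwise. Taking the positive part leaves the tails at positive levels unchanged.\<close>
    define U where "U j \<omega> = u j * max 0 (X j \<omega>)" for j \<omega>
    have A_pos: "0 < (\<Sum>i=0..n - j. m i)" for j
      using m by (intro sum_pos) auto
    then have u: "0 < u j" for j
      using x by (simp add: u_def)
    define I where "I = {1..n}"
    have I: "finite I" "\<And>j. j \<in> I \<Longrightarrow> j \<ge> 1" by (auto simp: I_def)
    have tailU: "prob {\<omega> \<in> space M. U j \<omega> > t} = tail_prob M (X 1) (t / u j)"
      if j: "j \<in> I" and t: "0 < t" for j t
    proof -
      have "U j \<omega> > t \<longleftrightarrow> X j \<omega> > t / u j" for \<omega>
      proof -
        have "U j \<omega> > t \<longleftrightarrow> max 0 (X j \<omega>) > t / u j"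
          using u[of j] by (simp add: U_def field_simps)
        also have "\<dots> \<longleftrightarrow> X j \<omega> > t / u j"
          using divide_pos_pos[OF t u[of j]] by auto
        finally show ?thesis .
      qed
      then have "prob {\<omega> \<in> space M. U j \<omega> > t} = tail_prob M (X j) (t / u j)"
        by (simp add: tail_prob_def)
      then show ?thesis using tail_prob_iid[OF M iid, of j] I(2)[OF j] by simp
    qed
    have scale: "(t / u j) powr - \<beta> = w j * t powr - \<beta>" if "0 < t" for t j
      using u[of j] that by (simp add: w_def powr_divide powr_minus field_simps)
    interpret heavy_sum M I U w \<beta> K
    proof
      show "indep_vars (\<lambda>_. borel) U I"
      proof -
        have "indep_vars (\<lambda>_. borel) X I"
          using iid I(2) by (auto simp: iid_seq_def intro: indep_vars_subset)
        from indep_vars_compose2[OF this, of "\<lambda>j z. u j * max 0 z" "\<lambda>_. borel"]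
        show ?thesis by (simp add: U_def[abs_def])
      qed
      show "0 \<le> U j \<omega>" for j \<omega>
        using u[of j] by (simp add: U_def)
      show "prob {\<omega> \<in> space M. U j \<omega> > t} \<le> K * w j * t powr - \<beta>"
        if "j \<in> I" "0 < t" for j t
        using K(2)[of "t / u j"] u[of j] that by (simp add: tailU scale mult.assoc)
    qed (use K I in \<open>auto simp: w_def\<close>)
    have "w j = (\<Sum>i=0..n - j. m i) powr \<beta> * x powr - \<beta>" for j
      using A_pos[of j] x by (simp add: w_def u_def powr_divide powr_minus field_simps)
    then have D: "D = L_seq \<beta> m n * x powr - \<beta>"
      unfolding D_def L_seq_def unfolding I_def by (simp add: sum_distrib_right)
    have near: "\<bar>prob {\<omega> \<in> space M. U j \<omega> > t} - c * (w j * t powr - \<beta>)\<bar> \<le> \<eta> * (w j * t powr - \<beta>)"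
      if j: "j \<in> I" and t: "1 - \<eta> \<le> t" for j t
    proof -
      have "w j \<le> D"
        unfolding D_def using j w_nonneg I by (intro member_le_sum) auto
      then have "u j powr \<beta> \<le> ((1 - \<eta>) / y) powr \<beta>"
        using small by (simp add: D \<delta>'_def w_def)
      then have "u j \<le> (1 - \<eta>) / y"
        using powr_less_mono2[OF \<beta>0, of "(1 - \<eta>) / y" "u j"] p(2) y(1) by (intro leI) fastforce
      then have "y * u j \<le> t"
        using y(1) t by (simp add: field_simps)
      then have "y \<le> t / u j"
        using u[of j] by (simp add: field_simps)
      then show ?thesis
        using y(2)[of "t / u j"] tailU[OF j, of t] t p(2) by (simp add: scale)
    qed
    have ub: "prob {\<omega> \<in> space M. U j \<omega> > 1 - \<eta>} \<le> (c + \<eta>) * w j * (1 - \<eta>) powr - \<beta>"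
      if "j \<in> I" for j
      using near[OF that, of "1 - \<eta>"] by (simp add: abs_le_iff algebra_simps)
    have lb: "(c - \<eta>) * w j * (1 + \<eta>) powr - \<beta> \<le> prob {\<omega> \<in> space M. U j \<omega> > 1 + \<eta>}"
      if "j \<in> I" for j
      using near[OF that, of "1 + \<eta>"] p(1) by (simp add: abs_le_iff algebra_simps)
    have D\<delta>: "D \<le> \<delta>" using small by (simp add: D \<delta>'_def)
    have X[measurable]: "X j \<in> borel_measurable M" if "j \<in> I" for j
      using iid I(2)[OF that] by (auto simp: iid_seq_def indep_vars_def)
    have AE: "AE \<omega> in M. S_proc m X n \<omega> = x * (\<Sum>j\<in>I. U j \<omega>)"
    proof -
      have "AE \<omega> in M. \<forall>j\<in>I. X j \<omega> \<ge> 0"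
        using X_nonneg I by (intro AE_finite_allI) auto
      then show ?thesis
      proof eventually_elim
        case (elim \<omega>)
        have "x * (\<Sum>j\<in>I. U j \<omega>) = (\<Sum>j\<in>I. x * U j \<omega>)"
          by (rule sum_distrib_left)
        also have "\<dots> = (\<Sum>j\<in>I. (\<Sum>i=0..n - j. m i) * X j \<omega>)"
        proof (rule sum.cong)
          fix j assume "j \<in> I"
          then have "max 0 (X j \<omega>) = X j \<omega>" using elim by (intro max.absorb2) blast
          then show "x * U j \<omega> = (\<Sum>i=0..n - j. m i) * X j \<omega>"
            using x by (simp add: U_def u_def)
        qed simp
        finally show ?case by (simp only: S_proc_eq_weighted_sum I_def)
      qed
    qed
    have S[measurable]: "S_proc m X n \<in> borel_measurable M"
      unfolding S_proc_eq_weighted_sum[abs_def] I_def[symmetric] by measurable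
    have centering: "centering M \<beta> m X n = x * center"
    proof (cases "\<beta> < 1")
      case False
      then have "1 < \<beta>" using \<beta> by auto
      \<comment> \<open>Any positive truncation level would do for integrability; 1 is
        chosen.\<close>
      then have int: "integrable M (U j)" if "j \<in> I" for j
        using integrable_U[OF that, of 1] by auto
      have "integral\<^sup>L M (S_proc m X n) = expectation (\<lambda>\<omega>. x * (\<Sum>j\<in>I. U j \<omega>))"
        using AE by (intro integral_cong_AE) auto
      also have "\<dots> = x * (\<Sum>j\<in>I. expectation (U j))"
        using int by simp
      finally show ?thesis using False by (simp add: centering_def center_def)
    qed (simp add: centering_def center_def)
    have "tail_prob M (\<lambda>\<omega>. S_proc m X n \<omega> - centering M \<beta> m X n) x
        = prob {\<omega> \<in> space M. (\<Sum>j\<in>I. U j \<omega>) - center > 1}"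
      unfolding tail_prob_def
    proof (rule measure_eq_AE)
      show "AE \<omega> in M. \<omega> \<in> {\<omega> \<in> space M. S_proc m X n \<omega> - centering M \<beta> m X n > x}
          \<longleftrightarrow> \<omega> \<in> {\<omega> \<in> space M. (\<Sum>j\<in>I. U j \<omega>) - center > 1}"
        using AE
      proof eventually_elim
        case (elim \<omega>)
        have "x < x * (\<Sum>j\<in>I. U j \<omega>) - x * center \<longleftrightarrow> x * 1 < x * ((\<Sum>j\<in>I. U j \<omega>) - center)"
          by (simp add: right_diff_distrib)
        also have "\<dots> \<longleftrightarrow> 1 < (\<Sum>j\<in>I. U j \<omega>) - center"
          using x by (rule mult_less_cancel_left_pos)
        finally show ?case by (simp add: elim centering)
      qed
    qed measurable
    moreover have "prob {\<omega> \<in> space M. (\<Sum>j\<in>I. U j \<omega>) - center > 1} \<le> (c + \<epsilon>) * D"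
      by (rule one_big_jump_le[OF \<beta> p(1,2,4) D\<delta> ub p(6,8,9,10)])
    moreover have "(c - \<epsilon>) * D \<le> prob {\<omega> \<in> space M. (\<Sum>j\<in>I. U j \<omega>) - center > 1}"
      by (rule one_big_jump_ge[OF \<beta> c \<epsilon> p(1,2,3,4) D\<delta> lb p(7,11,12)])
    ultimately show ?thesis
      by (simp add: D[symmetric] abs_le_iff algebra_simps)
  qed
  ultimately show ?thesis by blast
qed

section \<open>The uniform limit of the ratio\<close>

theorem corollary2:
  fixes M :: "'a measure" and X :: "nat \<Rightarrow> 'a \<Rightarrow> real"
    and m :: "nat \<Rightarrow> real" and \<beta> :: real
  assumes "prob_space M"
    and "\<beta> \<in> {0<..<2} - {1}"
    and "iid_seq M X"
    and "\<And>j. j \<ge> 1 \<Longrightarrow> AE \<omega> in M. X j \<omega> \<ge> 0"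
    and "normal_doa_spectrally_positive M \<beta> (X 1)"
    and "m 0 = 1"
    and "\<And>i. m i > 0"
  shows "\<forall>xs :: nat \<Rightarrow> real.
    filterlim xs at_top sequentially \<longrightarrow>
    (\<lambda>n. L_seq \<beta> m n * tail_prob M (X 1) (xs n)) \<longlonglongrightarrow> 0 \<longrightarrow>
    (\<lambda>n. SUP x\<in>{xs n..}.
        ereal \<bar>tail_prob M (\<lambda>\<omega>. S_proc m X n \<omega> - centering M \<beta> m X n) x
                / (L_seq \<beta> m n * tail_prob M (X 1) x) - 1\<bar>) \<longlonglongrightarrow> 0"
proof (intro allI impI)
  fix xs :: "nat \<Rightarrow> real"
  assume xs: "filterlim xs at_top sequentially"
    and L0: "(\<lambda>n. L_seq \<beta> m n * tail_prob M (X 1) (xs n)) \<longlonglongrightarrow> 0"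
  define F where "F = tail_prob M (X 1)"
  define P where "P n = tail_prob M (\<lambda>\<omega>. S_proc m X n \<omega> - centering M \<beta> m X n)" for n
  define L where "L = L_seq \<beta> m"
  have \<beta>0: "0 < \<beta>" using assms(2) by auto
  obtain c where c: "0 < c" and equiv: "tail_prob M (X 1) \<sim>[at_top] (\<lambda>x. c * x powr - \<beta>)"
    using assms(5) by (auto simp: normal_doa_spectrally_positive_def)
  have A_pos: "0 < (\<Sum>i=0..k. m i)" for k
    using assms(7) by (intro sum_pos) auto
  \<comment> \<open>\<open>L 0\<close> is an empty sum, so positivity starts at n = 1; the limit
    ignores the first term.\<close>
  have L_pos: "0 < L n" if "n \<ge> 1" for n
    unfolding L_def L_seq_def using that A_pos
    by (intro sum_pos) (auto simp: less_imp_neq[THEN not_sym])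
  have bound: "\<forall>\<^sub>F n in sequentially. \<forall>x\<ge>xs n. \<bar>P n x / (L n * F x) - 1\<bar> \<le> \<epsilon>"
    if \<epsilon>: "0 < \<epsilon>" for \<epsilon>
  proof -
    \<comment> \<open>The bound c/2 gives F(x) \<ge> (c/2) x^(-\<beta>) far out. With q =
      x^(-\<beta>), both \<open>P n x\<close> and \<open>L n * F x\<close> lie within e L_n q of c
      L_n q. They differ by at most 2 e L_n q = (4e/c) L_n (c/2) q, hence by at most \<epsilon> L_n
      F(x) once e \<le> c \<epsilon>/4.\<close>
    define e where "e = min (c / 2) (c * \<epsilon> / 4)"
    have e: "0 < e" "e \<le> c / 2" and "e \<le> c * \<epsilon> / 4"
      unfolding e_def using c \<epsilon> by (auto intro: min.cobounded1 min.cobounded2)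
    then have e': "4 * e / c \<le> \<epsilon>"
      using c by (simp only: pos_divide_le_eq mult.commute)
    have "\<exists>\<delta>>0. \<forall>n x. 0 < x \<longrightarrow> L n * x powr - \<beta> \<le> \<delta> \<longrightarrow>
        \<bar>P n x - c * (L n * x powr - \<beta>)\<bar> \<le> e * (L n * x powr - \<beta>)"
      unfolding P_def L_def
      by (rule tail_prob_S_proc_near[OF assms(1-4) c equiv assms(7) e(1)])
    then obtain \<delta> where \<delta>: "\<delta> > 0" "\<And>n x. 0 < x \<Longrightarrow> L n * x powr - \<beta> \<le> \<delta> \<Longrightarrow>
        \<bar>P n x - c * (L n * x powr - \<beta>)\<bar> \<le> e * (L n * x powr - \<beta>)"
      by auto
    obtain y where y: "y > 0" "\<And>x. x \<ge> y \<Longrightarrow> \<bar>F x - c * x powr - \<beta>\<bar> \<le> e * x powr - \<beta>"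
      using eventually_tail_near[OF assms(1) c \<beta>0 equiv e(1)] unfolding F_def by blast
    have F_ge: "c / 2 * x powr - \<beta> \<le> F x" if "x \<ge> y" for x
    proof -
      have "c / 2 * x powr - \<beta> \<le> (c - e) * x powr - \<beta>"
        using e by (intro mult_right_mono) auto
      then show ?thesis using y(2)[OF that] by (simp add: abs_le_iff algebra_simps)
    qed
    \<comment> \<open>Combined with the lower bound c/2 on the tail constant, this threshold gives
      L_n xs_n^(-\<beta>) \<le> \<delta>, and by monotonicity the same for all x \<ge> xs_n.\<close>
    have "\<forall>\<^sub>F n in sequentially. L n * F (xs n) < \<delta> * c / 2"
      using L0 \<delta> c unfolding L_def F_def by (intro order_tendstoD(2)) auto
    moreover have "\<forall>\<^sub>F n in sequentially. xs n \<ge> y"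
      using xs by (simp add: filterlim_at_top)
    ultimately show ?thesis
      using eventually_ge_at_top[of 1]
    proof eventually_elim
      case (elim n)
      show ?case
      proof (intro allI impI)
        fix x assume x: "x \<ge> xs n"
        have x0: "0 < x" "y \<le> x" "0 < xs n" using x elim y by auto
        define q where "q = x powr - \<beta>"
        have q: "0 < q" using x0 by (simp add: q_def)
        have Ln: "0 < L n" using L_pos elim by simp
        have "c / 2 * (L n * q) \<le> L n * (c / 2 * xs n powr - \<beta>)"
          using x x0 \<beta>0 c Ln powr_mono2'[of "- \<beta>" "xs n" x] by (simp add: q_def)
        also have "\<dots> \<le> L n * F (xs n)"
          using F_ge[of "xs n"] elim Ln by (intro mult_left_mono) auto
        also have "\<dots> \<le> c / 2 * \<delta>" using elim by (simp add: mult.commute)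
        finally have "L n * q \<le> \<delta>" using c by simp
        then have "\<bar>P n x - c * (L n * q)\<bar> \<le> e * (L n * q)"
          using \<delta>(2)[OF x0(1)] by (simp add: q_def)
        moreover have "\<bar>L n * F x - c * (L n * q)\<bar> \<le> e * (L n * q)"
        proof -
          have "L n * F x - c * (L n * q) = L n * (F x - c * q)"
            by (simp add: right_diff_distrib)
          then have "\<bar>L n * F x - c * (L n * q)\<bar> = L n * \<bar>F x - c * q\<bar>"
            using Ln by (simp only: abs_mult abs_of_pos)
          also have "\<dots> \<le> L n * (e * q)"
            using y(2)[OF x0(2)] Ln by (intro mult_left_mono) (auto simp: q_def)
          finally show ?thesis by (simp add: mult_ac)
        qed
        ultimately have "\<bar>P n x - L n * F x\<bar> \<le> 2 * e * (L n * q)" by linarith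
        also have "\<dots> = 4 * e / c * (L n * (c / 2 * q))" using c by simp
        also have "\<dots> \<le> \<epsilon> * (L n * F x)"
          using e e' F_ge[OF x0(2)] Ln c q \<epsilon> by (intro mult_mono) (auto simp: q_def)
        finally have diff: "\<bar>P n x - L n * F x\<bar> \<le> \<epsilon> * (L n * F x)" .
        have "0 < c / 2 * q" using c q by simp
        then have LF: "0 < L n * F x" using F_ge[OF x0(2)] Ln by (simp add: q_def)
        then have "P n x / (L n * F x) - 1 = (P n x - L n * F x) / (L n * F x)"
          by (auto simp: diff_divide_distrib)
        then have "\<bar>P n x / (L n * F x) - 1\<bar> = \<bar>P n x - L n * F x\<bar> / (L n * F x)"
          using LF by (simp only: abs_divide abs_of_pos)
        also have "\<dots> \<le> \<epsilon>" using diff LF by (simp add: pos_divide_le_eq)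
        finally show "\<bar>P n x / (L n * F x) - 1\<bar> \<le> \<epsilon>" .
      qed
    qed
  qed
  have "(\<lambda>n. SUP x\<in>{xs n..}. ereal \<bar>P n x / (L n * F x) - 1\<bar>) \<longlonglongrightarrow> 0"
  proof (rule order_tendstoI)
    fix a :: ereal assume "a < 0"
    moreover have "0 \<le> (SUP x\<in>{xs n..}. ereal \<bar>P n x / (L n * F x) - 1\<bar>)" for n
      by (intro SUP_upper2[of "xs n"]) auto
    ultimately show "\<forall>\<^sub>F n in sequentially. a < (SUP x\<in>{xs n..}. ereal \<bar>P n x / (L n * F x) - 1\<bar>)"
      by (intro always_eventually allI) (rule less_le_trans)
  next
    fix a :: ereal assume "0 < a"
    \<comment> \<open>The bound a may be infinite, hence the detour through a real \<epsilon>; the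
      strict gap also makes up for the supremum being only at most \<epsilon>.\<close>
    then obtain \<epsilon> where \<epsilon>: "0 < ereal \<epsilon>" "ereal \<epsilon> < a"
      using ereal_dense2 by blast
    have "\<forall>\<^sub>F n in sequentially. \<forall>x\<ge>xs n. \<bar>P n x / (L n * F x) - 1\<bar> \<le> \<epsilon>"
      using \<epsilon> by (intro bound) simp
    then show "\<forall>\<^sub>F n in sequentially. (SUP x\<in>{xs n..}. ereal \<bar>P n x / (L n * F x) - 1\<bar>) < a"
    proof eventually_elim
      case (elim n)
      then have "(SUP x\<in>{xs n..}. ereal \<bar>P n x / (L n * F x) - 1\<bar>) \<le> ereal \<epsilon>"
        by (intro SUP_least) simp
      then show ?case using \<epsilon>(2) by (rule le_less_trans)
    qed
  qed
  then show "(\<lambda>n. SUP x\<in>{xs n..}.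
        ereal \<bar>tail_prob M (\<lambda>\<omega>. S_proc m X n \<omega> - centering M \<beta> m X n) x
                / (L_seq \<beta> m n * tail_prob M (X 1) x) - 1\<bar>) \<longlonglongrightarrow> 0"
    by (simp only: P_def L_def F_def)
qed

end
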